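(* Let $\mathcal{R}$ be a finite nilpotent ring. Then, for a polynomial $f$ over $\mathcal{R}$ given as input, it can be decided whether or not the equation $f=0$ is solvable over $\mathcal{R}$ in $$O\left(\|f\|^{\,|\mathcal{R}|^{2\log|\mathcal{R}|}\,\log^5|\mathcal{R}|}\right)$$ time.
   Context: Rings are associative, not necessarily commutative and not necessarily unital; a ring $\mathcal{R}$ is nilpotent if there is a positive integer $t$ such that every product of $t$ elements of $\mathcal{R}$ is $0$. The ring $\mathcal{R}$ is fixed (not part of the input), and the implied constant in $O(\cdot)$ may depend on $\mathcal{R}$. A polynomial over $\mathcal{R}$ is an expression built from (noncommuting) variables and elements of $\mathcal{R}$ using ring addition (and subtraction) and multiplication; it is an arbitrary such expression, not necessarily written as a sum of monomials. $\|f\|$ denotes the length of the expression $f$. The equation $f=0$ is solvable over $\mathcal{R}$ if there is a substitution of elements of $\mathcal{R}$ for the variables of $f$ at which $f$ takes the value $0$. Here $\log$ is the logarithm to base $2$, and $\log^5|\mathcal{R}|=(\log|\mathcal{R}|)^5$. *)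

theory Defs
  imports Complex_Main "HOL-Library.Cardinality"
begin

text \<open>
  The type class \<^class>\<open>ring\<close> asks for neither commutativity nor a unit.  For lack of a unit, a product
  of \<open>t > 0\<close> factors is written \<open>foldl (*) x xs\<close> with \<open>t = Suc (length xs)\<close>.
\<close>

definition nilpotent_ring :: "'a::ring itself \<Rightarrow> bool" where
  "nilpotent_ring _ \<longleftrightarrow>
     (\<exists>t>0. \<forall>(x::'a) xs. Suc (length xs) = t \<longrightarrow> foldl (*) x xs = 0)"

datatype 'a expr =
    Var nat
  | Const 'a
  | Plus "'a expr" "'a expr"
  | Minus "'a expr" "'a expr"
  | Times "'a expr" "'a expr"

primrec eval_expr :: "(nat \<Rightarrow> 'a::ring) \<Rightarrow> 'a expr \<Rightarrow> 'a" where
  "eval_expr v (Var i) = v i"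
| "eval_expr v (Const a) = a"
| "eval_expr v (Plus f g) = eval_expr v f + eval_expr v g"
| "eval_expr v (Minus f g) = eval_expr v f - eval_expr v g"
| "eval_expr v (Times f g) = eval_expr v f * eval_expr v g"

definition solvable :: "'a::ring expr \<Rightarrow> bool" where
  "solvable f \<longleftrightarrow> (\<exists>v. eval_expr v f = 0)"

text \<open>
  Every occurrence of a variable, of a constant or of an operation counts as one symbol.  Counting
  parentheses as well would change the length by at most a constant factor.
\<close>

primrec expr_length :: "'a expr \<Rightarrow> nat" where
  "expr_length (Var i) = 1"
| "expr_length (Const a) = 1"
| "expr_length (Plus f g) = expr_length f + expr_length g + 1"
| "expr_length (Minus f g) = expr_length f + expr_length g + 1"
| "expr_length (Times f g) = expr_length f + expr_length g + 1"

text \<open>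
  Machine input: the expression in postfix notation, one positive number per symbol, where \<open>num\<close>
  numbers the elements of the ring by \<open>0, \<dots>, CARD('a) - 1\<close>.
\<close>

primrec encode_expr :: "('a \<Rightarrow> nat) \<Rightarrow> 'a expr \<Rightarrow> nat list" where
  "encode_expr num (Var i) = [4 + CARD('a) + i]"
| "encode_expr num (Const a) = [4 + num a]"
| "encode_expr num (Plus f g) = encode_expr num f @ encode_expr num g @ [1]"
| "encode_expr num (Minus f g) = encode_expr num f @ encode_expr num g @ [2]"
| "encode_expr num (Times f g) = encode_expr num f @ encode_expr num g @ [3]"

lemma length_encode_expr: "length (encode_expr num f) = expr_length f"
  by (induction f) simp_all

text \<open>
  Time is measured on the random access machine of Cook and Reckhow (Time bounded random access
  machines, 1973) with unit cost per instruction: there is no multiplication, and the registers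
  \<open>X\<^sub>0, X\<^sub>1, \<dots>\<close> hold natural numbers, with truncated subtraction.  The input is read
  sequentially; reading past its end yields \<open>0\<close>.  Instead of printing, the machine stops in one of
  the two instructions \<open>Accept\<close> and \<open>Reject\<close>; running out of the program is not halting.
\<close>

datatype instr =
    SetConst nat nat        \<comment> \<open>\<open>X\<^sub>i := c\<close>\<close>
  | AddReg nat nat nat      \<comment> \<open>\<open>X\<^sub>i := X\<^sub>j + X\<^sub>k\<close>\<close>
  | SubReg nat nat nat      \<comment> \<open>\<open>X\<^sub>i := X\<^sub>j - X\<^sub>k\<close>\<close>
  | Load nat nat            \<comment> \<open>\<open>X\<^sub>i := X[X\<^sub>j]\<close>\<close>
  | Store nat nat           \<comment> \<open>\<open>X[X\<^sub>i] := X\<^sub>j\<close>\<close>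
  | JumpPos nat nat         \<comment> \<open>go to instruction \<open>l\<close> if \<open>X\<^sub>j > 0\<close>\<close>
  | Read nat                \<comment> \<open>\<open>X\<^sub>i :=\<close> next input number\<close>
  | Accept
  | Reject

datatype config =
    Running nat "nat \<Rightarrow> nat" "nat list"  \<comment> \<open>program counter, registers, unread input\<close>
  | Halted bool

fun exec_instr :: "instr \<Rightarrow> nat \<Rightarrow> (nat \<Rightarrow> nat) \<Rightarrow> nat list \<Rightarrow> config" where
  "exec_instr (SetConst i c) pc X w = Running (Suc pc) (X(i := c)) w"
| "exec_instr (AddReg i j k) pc X w = Running (Suc pc) (X(i := X j + X k)) w"
| "exec_instr (SubReg i j k) pc X w = Running (Suc pc) (X(i := X j - X k)) w"
| "exec_instr (Load i j) pc X w = Running (Suc pc) (X(i := X (X j))) w"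
| "exec_instr (Store i j) pc X w = Running (Suc pc) (X(X i := X j)) w"
| "exec_instr (JumpPos l j) pc X w = Running (if X j > 0 then l else Suc pc) X w"
| "exec_instr (Read i) pc X w =
     Running (Suc pc) (X(i := (case w of [] \<Rightarrow> 0 | a # _ \<Rightarrow> a))) (tl w)"
| "exec_instr Accept pc X w = Halted True"
| "exec_instr Reject pc X w = Halted False"

fun step :: "instr list \<Rightarrow> config \<Rightarrow> config" where
  "step P (Running pc X w) =
     (if pc < length P then exec_instr (P ! pc) pc X w else Running pc X w)"
| "step P (Halted b) = Halted b"

definition init_config :: "nat list \<Rightarrow> config" where
  "init_config w = Running 0 (\<lambda>_. 0) w"

text \<open>
  One program decides all instances \<open>x\<close> of the problem \<open>Q\<close>, presented as \<open>enc x\<close>, in \<open>O(T x)\<close> steps.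
\<close>

definition decidable_in_O_time :: "('i \<Rightarrow> nat list) \<Rightarrow> ('i \<Rightarrow> bool) \<Rightarrow> ('i \<Rightarrow> real) \<Rightarrow> bool" where
  "decidable_in_O_time enc Q T \<longleftrightarrow>
     (\<exists>P C. \<forall>x. \<exists>t. real t \<le> C * T x \<and> (step P ^^ t) (init_config (enc x)) = Halted (Q x))"

end

theory Submission
  imports Defs "HOL-Number_Theory.Cong"
begin

text \<open>
  If \<open>f = 0\<close> has a solution over a nilpotent ring with \<open>N\<close> elements, then it has one with at most
  \<open>(N - 1) ^ 4\<close> nonzero variables, and a random access machine tries all of these.

  For the bound, treat each prime \<open>p\<close> dividing \<open>N\<close> separately, since a solution may be
  assembled from its \<open>p\<close>-components.  Switching off the variables in a subset \<open>u\<close> of the support of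
  a solution turns \<open>f\<close> into a multilinear polynomial of degree less than \<open>N\<close> in the indicator of \<open>u\<close>,
  because products of \<open>N\<close> elements vanish.  As in Olson's theorem on the Davenport constant, the
  augmentation ideal of the group ring of a \<open>p\<close>-group over the field with \<open>p\<close> elements is nilpotent;
  hence the sum of \<open>(-1) ^ card u\<close> over all \<open>u\<close> that again give a solution is divisible by \<open>p\<close> as
  soon as the support has more than \<open>(N - 1) ^ 3\<close> elements.  So some \<open>u \<noteq> {}\<close> can be switched off.
\<close>

section \<open>Solutions of small support\<close>

text \<open>In \<open>(N - 1) ^ 3\<close>, two factors come from the group ring:
  \<open>(N - 1)^2 + 1\<close> factors X^a - 1 force divisibility by p. The third is the degree,
  since each such factor, produced by one monomial, pins at most \<open>N - 1\<close> of the
  variables that could be switched. The fourth factor of \<open>(N - 1) ^ 4\<close> crudely bounds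
  the number of primes dividing N. A nilpotent ring has no nonzero idempotents, so its p-components
  are cut out by integer multipliers instead of ring elements. The expansion into monomials lives
  only in the argument: it can be exponentially long, so the machine evaluates the expression as
  given. Variable indices are not bounded by the input length n either. A nonzero variable is
  therefore guessed through a position where it occurs, which leaves n * N possibilities per guess
  and O(n ^ ((N - 1) ^ 4 + 1)) steps in all. For N at least 2 this exponent is below the required
  one; for N = 1 the required time is constant.\<close>

lemma foldl_times_Cons: "foldl (*) (x * y) zs = x * foldl (*) y zs" for x :: "'a::semigroup_mult"
  by (induction zs arbitrary: y) (simp_all add: mult.assoc)

lemma foldl_times_append:
  "foldl (*) x (ys @ z # zs) = foldl (*) x ys * foldl (*) z zs" for x :: "'a::semigroup_mult"
  by (simp add: foldl_times_Cons)

lemma foldl_times_zero: "foldl (*) 0 zs = (0 :: 'a::ring)"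
  by (induction zs) simp_all

text \<open>Pigeonhole on partial products: if the product is nonzero, at least N prefixes take only
  N - 1 nonzero values, so two agree. The factors between them form some \<open>c\<close> with
  \<open>q i * c = q i\<close>; absorbing \<open>c\<close> repeatedly writes \<open>q i\<close> as a
  product of t factors, hence as 0.\<close>

lemma nilpotent_prod_card:
  fixes x :: "'a::{finite,ring}"
  assumes "nilpotent_ring TYPE('a)" and len: "CARD('a) \<le> Suc (length xs)"
  shows "foldl (*) x xs = 0"
proof (rule ccontr)
  assume nz: "foldl (*) x xs \<noteq> 0"
  obtain t where "t > 0" and t: "\<And>(y::'a) ys. Suc (length ys) = t \<Longrightarrow> foldl (*) y ys = 0"
    using assms(1) unfolding nilpotent_ring_def by blast
  define q where "q i = foldl (*) x (take i xs)" for i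
  have q_split: "foldl (*) (q i) (drop i xs) = foldl (*) x xs" for i
    unfolding q_def by (metis append_take_drop_id foldl_append)
  have q_nz: "q i \<noteq> 0" for i
    using q_split[of i] nz by (metis foldl_times_zero)
  have "card (q ` {..length xs}) \<le> card (UNIV - {0::'a})"
    by (rule card_mono) (use q_nz in auto)
  also have "\<dots> < card {..length xs}"
    using len by (simp add: card_Diff_singleton)
  finally have "\<not> inj_on q {..length xs}"
    by (rule pigeonhole)
  then obtain i j where ij: "i < j" "j \<le> length xs" "q i = q j"
    unfolding inj_on_def by (metis atMost_iff linorder_neq_iff)
  define ys where "ys = take (j - i) (drop i xs)"
  have "take j xs = take i xs @ ys"
    using ij take_add[of i "j - i" xs] by (simp add: ys_def)
  then have "q j = foldl (*) (q i) ys"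
    by (simp add: q_def)
  moreover have "ys \<noteq> []"
    using ij by (simp add: ys_def)
  then obtain z zs where ys: "ys = z # zs"
    by (cases ys) auto
  ultimately have fix_q: "q i * foldl (*) z zs = q i"
    using ij(3) by (simp add: foldl_times_Cons)
  define c where "c = foldl (*) z zs"
  have "foldl (*) (q i) (replicate k c) = q i" for k
    by (induction k) (use fix_q c_def in auto)
  then have "q i = 0"
    using t[of "replicate (t - 1) c" "q i"] \<open>t > 0\<close> by simp
  then show False
    using q_nz by simp
qed

text \<open>Integer multiples in the additive group; without a unit, \<open>of_nat\<close> cannot
  supply them as ring elements.\<close>

definition nmul :: "nat \<Rightarrow> 'a::ab_group_add \<Rightarrow> 'a" where
  "nmul n x = (\<Sum>i<n. x)"

lemma nmul_0 [simp]: "nmul 0 x = 0"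
  and nmul_Suc: "nmul (Suc n) x = nmul n x + x"
  and nmul_zero [simp]: "nmul n 0 = 0"
  and nmul_plus: "nmul n (x + y) = nmul n x + nmul n y"
  and nmul_diff: "nmul n (x - y) = nmul n x - nmul n y"
  by (simp_all add: nmul_def sum.distrib sum_subtractf)

lemma nmul_one [simp]: "nmul (Suc 0) x = x"
  by (simp add: nmul_Suc)

lemma nmul_add: "nmul (m + n) x = nmul m x + nmul n x"
  by (induction n) (simp_all add: nmul_Suc add.assoc)

lemma nmul_nmul: "nmul m (nmul n x) = nmul (m * n) x"
  by (induction m) (simp_all add: nmul_Suc nmul_add add.commute)

lemma nmul_sum: "nmul n (sum g A) = (\<Sum>a\<in>A. nmul n (g a))"
  unfolding nmul_def by (rule sum.swap)

lemma nmul_times_left: "nmul n x * y = nmul n (x * y)" for x :: "'a::ring"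
  by (simp add: nmul_def sum_distrib_right)

lemma nmul_times_right: "x * nmul n y = nmul n (x * y)" for x :: "'a::ring"
  by (simp add: nmul_def sum_distrib_left)

text \<open>Translation by \<open>x\<close> permutes the group, so the sum of all elements equals
  itself plus N times \<open>x\<close>.\<close>

lemma nmul_card: "nmul (CARD('a)) x = 0" for x :: "'a::{finite,ab_group_add}"
proof -
  have "(\<Sum>y\<in>UNIV. y) = (\<Sum>y\<in>UNIV. y + x)"
    by (rule sum.reindex_bij_witness[of _ "\<lambda>y. y + x" "\<lambda>y. y - x"]) auto
  then have "(\<Sum>y\<in>(UNIV::'a set). x) = 0"
    by (simp add: sum.distrib)
  moreover have "(\<Sum>y\<in>A. x) = nmul (card A) x" if "finite A" for A :: "'a set"
    using that by induction (simp_all add: nmul_Suc add.commute)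
  ultimately show ?thesis
    by simp
qed

lemma nmul_dvd: "nmul (CARD('a)) x = 0 \<Longrightarrow> CARD('a) dvd m \<Longrightarrow> nmul m x = 0"
  for x :: "'a::{finite,ab_group_add}"
  by (metis dvd_div_mult_self nmul_nmul nmul_zero)

lemma nmul_cong:
  fixes x :: "'a::{finite,ab_group_add}"
  assumes "[m = n] (mod CARD('a))"
  shows "nmul m x = nmul n x"
proof -
  have "nmul k x = nmul (k mod CARD('a)) x" for k
    using nmul_add[of "CARD('a) * (k div CARD('a))" "k mod CARD('a)" x]
      nmul_dvd[OF nmul_card, of "CARD('a) * (k div CARD('a))" x] by simp
  then show ?thesis
    using assms unfolding cong_def by metis
qed

section \<open>Finite differences modulo a prime\<close>

text \<open>The action of the group ring element X^a - 1 on functions. Working with integer-valued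
  functions and divisibility by p avoids constructing the group ring over the field with p
  elements.\<close>

definition fdiff :: "'a::ab_group_add \<Rightarrow> ('a \<Rightarrow> int) \<Rightarrow> 'a \<Rightarrow> int" where
  "fdiff a \<phi> x = \<phi> (x + a) - \<phi> x"

lemma fdiff_commute: "fdiff a (fdiff b \<phi>) = fdiff b (fdiff a \<phi>)"
  by (rule ext) (simp add: fdiff_def algebra_simps)

text \<open>Binomial expansion of (X^a - 1)^m; the sign is written with m + j, which has the parity
  of m - j.\<close>

lemma fdiff_power:
  "(fdiff a ^^ m) \<phi> x = (\<Sum>j\<le>m. (-1) ^ (m + j) * int (m choose j) * \<phi> (x + nmul j a))"
proof (induction m arbitrary: x)
  case (Suc m)
  let ?c = "\<lambda>m j. (-1::int) ^ (m + j) * int (m choose j)"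
  have "(fdiff a ^^ Suc m) \<phi> x = (fdiff a ^^ m) \<phi> (x + a) - (fdiff a ^^ m) \<phi> x"
    by (simp add: fdiff_def)
  also have "\<dots> = (\<Sum>j\<le>m. ?c m j * \<phi> (x + nmul (Suc j) a))
      - (\<Sum>j\<le>Suc m. ?c m j * \<phi> (x + nmul j a))"
    by (simp add: Suc nmul_Suc add_ac)
  also have "(\<Sum>j\<le>Suc m. ?c m j * \<phi> (x + nmul j a)) =
      ?c m 0 * \<phi> x + (\<Sum>j\<le>m. ?c m (Suc j) * \<phi> (x + nmul (Suc j) a))"
    by (simp only: sum.atMost_Suc_shift) simp
  also have "(\<Sum>j\<le>m. ?c m j * \<phi> (x + nmul (Suc j) a)) - \<dots> =
      ?c (Suc m) 0 * \<phi> x + (\<Sum>j\<le>m. ?c (Suc m) (Suc j) * \<phi> (x + nmul (Suc j) a))"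
    by (simp add: sum_subtractf [symmetric] algebra_simps sum.distrib)
  also have "\<dots> = (\<Sum>j\<le>Suc m. ?c (Suc m) j * \<phi> (x + nmul j a))"
    by (simp only: sum.atMost_Suc_shift) simp
  finally show ?case .
qed simp

text \<open>From \<open>j * (q choose j) = q * (q - 1 choose j - 1)\<close> with
  \<open>q = p ^ k\<close>: if p did not divide the binomial coefficient, then q would divide j,
  although 0 < j < q.\<close>

lemma prime_dvd_prime_power_choose:
  fixes p :: nat
  assumes "prime p" "0 < j" "j < p ^ k"
  shows "p dvd (p ^ k choose j)"
proof (rule ccontr)
  assume "\<not> ?thesis"
  then have "coprime (p ^ k) (p ^ k choose j)"
    using assms(1) by (simp add: prime_imp_coprime)
  moreover have "j * (p ^ k choose j) = p ^ k * ((p ^ k - 1) choose (j - 1))"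
    using assms by (metis binomial_absorption Suc_pred' gr_implies_not0 not_gr_zero Suc_diff_1 times_binomial_minus1_eq)
  then have "p ^ k dvd j * (p ^ k choose j)"
    by simp
  ultimately have "p ^ k dvd j"
    by (simp add: coprime_dvd_mult_left_iff)
  then show False
    using assms by (simp add: nat_dvd_not_less)
qed

text \<open>The Frobenius identity: modulo p, (X^a - 1)^q = X^(qa) - 1 = 0 when q is a power of p
  that annihilates a.\<close>

lemma fdiff_prime_power:
  fixes p :: nat
  assumes "prime p" and a: "nmul (p ^ k) a = 0"
  shows "int p dvd (fdiff a ^^ (p ^ k)) \<phi> x"
proof -
  let ?q = "p ^ k"
  let ?s = "\<lambda>j. (-1) ^ (?q + j) * int (?q choose j) * \<phi> (x + nmul j a)"
  have q: "?q > 0"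
    using assms(1) by (simp add: prime_gt_0_nat)
  have "(\<Sum>j\<le>?q. ?s j) = (\<Sum>j\<in>{0,?q}. ?s j) + (\<Sum>j\<in>{0<..<?q}. ?s j)"
    by (subst sum.union_disjoint [symmetric]) (auto intro!: sum.cong)
  moreover have "int p dvd (\<Sum>j\<in>{0<..<?q}. ?s j)"
    using prime_dvd_prime_power_choose[OF assms(1)]
    by (intro dvd_sum) (simp add: dvd_mult dvd_mult2)
  \<comment> \<open>As q times a is 0, the two end terms add up to ((-1)^q + 1) * \<phi>(x): zero
    for odd q, and twice \<phi>(x) for even q, where p = 2.\<close>
  moreover have "int p dvd (\<Sum>j\<in>{0,?q}. ?s j)"
  proof (cases "even ?q")
    case True
    then have "p = 2"
      using assms(1) by (metis prime_dvd_power primes_dvd_imp_eq two_is_prime_nat)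
    then show ?thesis
      using q a True by simp
  next
    case False
    then show ?thesis
      using q a by simp
  qed
  ultimately show ?thesis
    by (simp add: fdiff_power)
qed

lemma fold_fdiff_dvd:
  assumes "\<And>x. int p dvd \<phi> x"
  shows "int p dvd fold fdiff as \<phi> x"
  using assms
proof (induction as arbitrary: \<phi>)
  case (Cons a as)
  have "int p dvd fdiff a \<phi> x" for x
    using Cons.prems by (simp add: fdiff_def)
  then show ?case
    using Cons.IH by simp
qed simp

lemma fold_fdiff_replicate: "fold fdiff (replicate m a) \<phi> = (fdiff a ^^ m) \<phi>"
  by (induction m arbitrary: \<phi>) (simp_all add: funpow_swap1 del: funpow.simps(2) add: funpow_Suc_right)

text \<open>
  In the group ring of a \<open>p\<close>-group over the field with \<open>p\<close> elements, a product of more than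
  \<open>(N - 1)\<^sup>2\<close> factors \<open>X\<^sup>a - 1\<close> contains some \<open>(X\<^sup>a - 1) ^ p\<^sup>k\<close> with \<open>p\<^sup>k \<le> N\<close>, which vanishes.
\<close>
lemma fold_fdiff_vanishes:
  fixes as :: "'a::{finite,ab_group_add} list" and p :: nat
  assumes p: "prime p" and pk: "p ^ k \<le> CARD('a)"
    and as: "\<And>a. a \<in> set as \<Longrightarrow> nmul (p ^ k) a = 0"
    and len: "(CARD('a) - 1)\<^sup>2 < length as"
  shows "int p dvd fold fdiff as \<phi> x"
proof -
  \<comment> \<open>The difference operators commute, so all copies of \<open>a\<close> can be
    applied first.\<close>
  have perm: "fold fdiff as \<phi> = fold fdiff (filter (\<lambda>b. b \<noteq> a) as) (fold fdiff (replicate m a) \<phi>)"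
    if "count (mset as) a = m" for a m
  proof -
    have "fold fdiff as = fold fdiff (replicate m a @ filter (\<lambda>b. b \<noteq> a) as)"
    proof (rule fold_multiset_equiv)
      show "mset as = mset (replicate m a @ filter (\<lambda>b. b \<noteq> a) as)"
        using that by (auto simp: multiset_eq_iff count_mset)
    qed (simp add: fun_eq_iff fdiff_commute)
    then show ?thesis
      by simp
  qed
  show ?thesis
  \<comment> \<open>The factor X^0 - 1 is zero. Without it only N - 1 values remain for more than (N
    - 1)^2 factors, so one value occurs at least N times, hence at least p^k times.\<close>
  proof (cases "0 \<in> set as")
    case True
    then obtain m where "count (mset as) 0 = Suc m"
      by (metis count_mset_0_iff not0_implies_Suc)
    moreover have "fold fdiff (replicate (Suc m) 0) \<phi> x = 0" for x
      unfolding fold_fdiff_replicate by (simp add: fdiff_def)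
    ultimately show ?thesis
      using perm[of 0 "Suc m"] by (simp only: fold_fdiff_dvd dvd_0_right)
  next
    case False
    have "\<exists>a. CARD('a) \<le> count (mset as) a"
    proof (rule ccontr)
      assume "\<not> ?thesis"
      then have "count (mset as) a \<le> CARD('a) - 1" for a
        by (metis Suc_pred' not_le less_Suc_eq_le zero_less_card_finite)
      then have "(\<Sum>a\<in>set as. count (mset as) a) \<le> card (set as) * (CARD('a) - 1)"
        using sum_bounded_above[of "set as" "count (mset as)" "CARD('a) - 1"] by simp
      also have "\<dots> \<le> (CARD('a) - 1) * (CARD('a) - 1)"
      proof -
        have "card (set as) \<le> card (UNIV - {0::'a})"
          using False by (intro card_mono) auto
        then show ?thesis
          by (simp add: card_Diff_singleton)
      qed
      also have "(\<Sum>a\<in>set as. count (mset as) a) = length as"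
        by (metis size_mset size_multiset_overloaded_eq set_mset_mset)
      finally show False
        using len by (simp add: power2_eq_square)
    qed
    then obtain a where a: "CARD('a) \<le> count (mset as) a" ..
    define m where "m = count (mset as) a - p ^ k"
    have cnt: "count (mset as) a = m + p ^ k"
      using a pk by (simp add: m_def)
    have "a \<in> set as"
      using cnt p by (metis add_is_0 count_mset_0_iff not_prime_0 power_not_zero)
    then have "int p dvd (fdiff a ^^ (p ^ k)) \<phi> x" for x
      by (intro fdiff_prime_power p as)
    then have "int p dvd fold fdiff (replicate m a) ((fdiff a ^^ (p ^ k)) \<phi>) x" for x
      by (rule fold_fdiff_dvd)
    moreover have "fold fdiff (replicate (m + p ^ k) a) \<phi> =
        fold fdiff (replicate m a) ((fdiff a ^^ (p ^ k)) \<phi>)"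
      by (simp add: fold_fdiff_replicate funpow_add)
    ultimately show ?thesis
      using perm[OF cnt] by (simp only: fold_fdiff_dvd)
  qed
qed

text \<open>
  The pair \<open>(T, a)\<close> stands for the monomial \<open>a * (\<Prod>i\<in>T. x\<^sub>i)\<close> in \<open>0\<close>/\<open>1\<close> variables, evaluated at the
  indicator function of \<open>u\<close>.
\<close>

definition set_poly :: "(nat set \<times> 'a::ab_group_add) list \<Rightarrow> nat set \<Rightarrow> 'a" where
  "set_poly L u = (\<Sum>(T, a)\<leftarrow>L. if T \<subseteq> u then a else 0)"

lemma set_poly_Nil [simp]: "set_poly [] u = 0"
  and set_poly_Cons [simp]: "set_poly (b # L) u = (if fst b \<subseteq> u then snd b else 0) + set_poly L u"
  and set_poly_append: "set_poly (L @ L') u = set_poly L u + set_poly L' u"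
  by (simp_all add: set_poly_def split_beta)

section \<open>Alternating sums over the subsets between two sets\<close>

text \<open>Toggling an element \<open>m\<close> of \<open>M - S\<close> pairs the sets
  \<open>u\<close> with opposite signs.\<close>

lemma alternating_sum_interval:
  assumes "finite M" "S \<subset> M"
  shows "(\<Sum>u | S \<subseteq> u \<and> u \<subseteq> M. (-1) ^ card u) = (0 :: int)"
proof -
  obtain m where m: "m \<in> M" "m \<notin> S"
    using assms(2) by auto
  let ?U = "{u. S \<subseteq> u \<and> u \<subseteq> M}" and ?A = "{u. S \<subseteq> u \<and> u \<subseteq> M - {m}}"
  have fin: "finite ?A"
    using assms(1) by simp
  have U: "?U = ?A \<union> insert m ` ?A"
  proof (intro equalityI subsetI)
    fix u assume "u \<in> ?U"
    then show "u \<in> ?A \<union> insert m ` ?A"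
      using m by (cases "m \<in> u") (auto intro!: image_eqI[of _ _ "u - {m}"])
  qed (use m in auto)
  have inj: "inj_on (insert m) ?A"
    by (rule inj_onI) (auto simp: insert_eq_iff)
  have "(\<Sum>u\<in>?U. (-1) ^ card u) = (\<Sum>u\<in>?A. (-1) ^ card u) + (\<Sum>u\<in>?A. (-1 :: int) ^ card (insert m u))"
    unfolding U using fin inj
    by (subst sum.union_disjoint) (auto simp: sum.reindex)
  also have "(\<Sum>u\<in>?A. (-1 :: int) ^ card (insert m u)) = (\<Sum>u\<in>?A. - ((-1) ^ card u))"
  proof (rule sum.cong)
    fix u assume "u \<in> ?A"
    then have "finite u" "m \<notin> u"
      using assms(1) finite_subset by auto
    then show "(-1 :: int) ^ card (insert m u) = - ((-1) ^ card u)"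
      by simp
  qed simp
  finally show ?thesis
    by (simp add: sum_negf)
qed

text \<open>Monomials are removed one at a time through
  \<open>\<phi> (y + a) = \<phi> y + fdiff a \<phi> y\<close>, where the second term arises only if
  T is contained in \<open>u\<close>. That term consumes one of the \<open>K\<close> differences and
  enlarges \<open>S\<close> by at most \<open>d\<close> elements; hence the generalization over
  \<open>K\<close>, \<open>\<phi>\<close> and \<open>S\<close>. For \<open>K > 0\<close> the budget
  says \<open>(K - 1) * d < card (M - S)\<close>. When no monomial is left, either
  \<open>K = 0\<close> and \<open>\<phi>\<close> itself is divisible by p, or \<open>S\<close> is
  still proper in \<open>M\<close> and the signs cancel.\<close>

lemma alternating_sum_set_poly:
  fixes p d :: nat
  assumes M: "finite M"
    and L: "\<And>T a. (T, a) \<in> set L \<Longrightarrow> card T \<le> d \<and> a \<in> A"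
    and \<phi>: "\<And>as y. length as = K \<Longrightarrow> set as \<subseteq> A \<Longrightarrow> int p dvd fold fdiff as \<phi> y"
    and "S \<subseteq> M" and "K * d < card (M - S) + d"
  shows "int p dvd (\<Sum>u | S \<subseteq> u \<and> u \<subseteq> M. (-1) ^ card u * \<phi> (x + set_poly L u))"
  using L \<phi> \<open>S \<subseteq> M\<close> \<open>K * d < card (M - S) + d\<close>
proof (induction L arbitrary: K \<phi> S x)
  case Nil
  show ?case
  proof (cases "K = 0")
    case True
    then show ?thesis
      using Nil.prems(2)[of "[]"] by (intro dvd_sum) simp
  next
    case False
    then have "d \<le> K * d"
      by simp
    then have "card (M - S) > 0"
      using Nil.prems by linarith
    then have "S \<subset> M"
      using Nil.prems by (metis Diff_cancel card.empty less_irrefl psubsetI)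
    then have "(\<Sum>u | S \<subseteq> u \<and> u \<subseteq> M. (-1) ^ card u * \<phi> (x + set_poly [] u)) = 0"
      using alternating_sum_interval[OF M] by (simp flip: sum_distrib_right)
    then show ?thesis
      by simp
  qed
next
  case (Cons Ta L)
  obtain T a where Ta: "Ta = (T, a)"
    by (cases Ta)
  have T: "card T \<le> d" and a: "a \<in> A"
    using Cons.prems(1) Ta by auto
  show ?case
  proof (cases K)
    case 0
    then show ?thesis
      using Cons.prems(2)[of "[]"] by (intro dvd_sum) simp
  next
    case (Suc K')
    let ?U = "{u. S \<subseteq> u \<and> u \<subseteq> M}"
    let ?V = "{u. S \<union> T \<subseteq> u \<and> u \<subseteq> M}"
    have finU: "finite ?U"
      using M by simp
    have VU: "?V = {u \<in> ?U. T \<subseteq> u}"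
      by auto
    have "(\<Sum>u\<in>?U. (-1) ^ card u * \<phi> (x + set_poly (Ta # L) u)) =
        (\<Sum>u\<in>?U. (-1) ^ card u * \<phi> (x + set_poly L u)
          + (if T \<subseteq> u then (-1) ^ card u * fdiff a \<phi> (x + set_poly L u) else 0))"
      by (rule sum.cong) (auto simp: Ta fdiff_def algebra_simps)
    also have "\<dots> = (\<Sum>u\<in>?U. (-1) ^ card u * \<phi> (x + set_poly L u))
        + (\<Sum>u\<in>?V. (-1) ^ card u * fdiff a \<phi> (x + set_poly L u))"
      unfolding VU by (simp only: sum.distrib sum.inter_filter[OF finU])
    finally have eq: "(\<Sum>u\<in>?U. (-1) ^ card u * \<phi> (x + set_poly (Ta # L) u)) = \<dots>" .
    have 1: "int p dvd (\<Sum>u\<in>?U. (-1) ^ card u * \<phi> (x + set_poly L u))"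
      by (rule Cons.IH[of K]) (use Cons.prems in auto)
    have 2: "int p dvd (\<Sum>u\<in>?V. (-1) ^ card u * fdiff a \<phi> (x + set_poly L u))"
    proof (cases "S \<union> T \<subseteq> M")
      case True
      have "card (M - S) \<le> card (M - (S \<union> T)) + card T"
      proof -
        have "finite T"
          using True M finite_subset by blast
        have "card (M - S) \<le> card ((M - (S \<union> T)) \<union> T)"
          by (rule card_mono) (use M \<open>finite T\<close> in auto)
        then show ?thesis
          using card_Un_le order_trans by blast
      qed
      then have "K' * d < card (M - (S \<union> T)) + d"
        using Cons.prems(4) T Suc by simp
      moreover have "int p dvd fold fdiff as (fdiff a \<phi>) y"
        if "length as = K'" "set as \<subseteq> A" for as y
        using Cons.prems(2)[of "a # as" y] that a Suc by simp
      ultimately show ?thesis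
        using Cons.prems(1) True by (intro Cons.IH[of K']) auto
    next
      case False
      then have "?V = {}"
        by auto
      then show ?thesis
        by (simp only: sum.empty) simp
    qed
    show ?thesis
      unfolding eq using 1 2 by (rule dvd_add)
  qed
qed

section \<open>Expressions as multilinear polynomials\<close>

text \<open>Records the number of factors of a coefficient, so that a monomial in at least N
  variables has coefficient 0 in a nilpotent ring. Monomials with equal variable sets are kept apart
  in the list because a sum of long products need not be one.\<close>

definition long_product :: "nat \<Rightarrow> 'a::ring \<Rightarrow> bool" where
  "long_product k x \<longleftrightarrow> (\<exists>y ys. k \<le> Suc (length ys) \<and> x = foldl (*) y ys)"

lemma long_product_le_1: "k \<le> 1 \<Longrightarrow> long_product k x"
  unfolding long_product_def by (rule exI[of _ x], rule exI[of _ "[]"]) simp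

lemma long_product_mono: "long_product k x \<Longrightarrow> l \<le> k \<Longrightarrow> long_product l x"
  unfolding long_product_def using order_trans by blast

lemma long_product_uminus: "long_product k x \<Longrightarrow> long_product k (- x)"
proof -
  have "- foldl (*) y ys = foldl (*) (- y) ys" for y :: 'a and ys
    by (induction ys arbitrary: y) simp_all
  then show "long_product k x \<Longrightarrow> long_product k (- x)"
    unfolding long_product_def by metis
qed

lemma long_product_times:
  assumes "long_product k x" "long_product l y"
  shows "long_product (k + l) (x * y)"
proof -
  obtain a as b bs where "k \<le> Suc (length as)" "x = foldl (*) a as"
    "l \<le> Suc (length bs)" "y = foldl (*) b bs"
    using assms unfolding long_product_def by blast
  then have "x * y = foldl (*) a (as @ b # bs)" "k + l \<le> Suc (length (as @ b # bs))"
    by (simp_all only: foldl_times_append length_append) simp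
  then show ?thesis
    unfolding long_product_def by blast
qed

lemma set_poly_map: "h 0 = 0 \<Longrightarrow> (\<And>x y. h (x + y) = h x + h y) \<Longrightarrow>
  set_poly (map (\<lambda>(T, a). (T, h a)) L) u = h (set_poly L u)"
  by (induction L) auto

lemma set_poly_filter: "set_poly (filter (\<lambda>(T, a). a \<noteq> 0) L) u = set_poly L u"
  by (induction L) auto

lemma set_poly_times:
  fixes L L' :: "(nat set \<times> 'a::ring) list"
  shows "set_poly (concat (map (\<lambda>(T, a). map (\<lambda>(T', b). (T \<union> T', a * b)) L') L)) u = set_poly L u * set_poly L' u"
proof (induction L)
  case (Cons Ta L)
  obtain T a where Ta: "Ta = (T, a)"
    by (cases Ta)
  have "set_poly (map (\<lambda>(T', b). (T \<union> T', a * b)) L') u = (if T \<subseteq> u then a else 0) * set_poly L' u"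
    by (cases "T \<subseteq> u"; induction L') (simp_all add: distrib_left split_beta)
  then show ?case
    using Cons by (simp add: Ta set_poly_append distrib_right)
qed simp

text \<open>Every variable in a monomial brings its own ring factor \<open>- v i\<close>, so degree
  never exceeds coefficient length. Indicators are idempotent, so variable sets are united in a
  product; this can only lower the degree.\<close>

lemma eval_expr_set_poly:
  fixes f :: "'a::ring expr"
  shows "\<exists>L. (\<forall>(T, a)\<in>set L. long_product (card T) a) \<and>
    (\<forall>u. eval_expr (\<lambda>i. if i \<in> u then 0 else v i) f = set_poly L u)"
proof (induction f)
  case (Var i)
  show ?case
    \<comment> \<open>The switched variable is \<open>v i\<close> minus \<open>v i\<close> times the
      indicator of \<open>i\<close> in \<open>u\<close>.\<close>
    by (rule exI[of _ "[({}, v i), ({i}, - v i)]"]) (simp add: long_product_le_1)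
next
  case (Const c)
  show ?case
    by (rule exI[of _ "[({}, c)]"]) (simp add: long_product_le_1)
next
  case (Plus f g)
  then obtain L L' where L: "\<forall>(T, a)\<in>set L. long_product (card T) a"
      "\<forall>u. eval_expr (\<lambda>i. if i \<in> u then 0 else v i) f = set_poly L u"
    and L': "\<forall>(T, a)\<in>set L'. long_product (card T) a"
      "\<forall>u. eval_expr (\<lambda>i. if i \<in> u then 0 else v i) g = set_poly L' u"
    by blast
  show ?case
    by (rule exI[of _ "L @ L'"]) (use L L' in \<open>auto simp: set_poly_append\<close>)
next
  case (Minus f g)
  then obtain L L' where L: "\<forall>(T, a)\<in>set L. long_product (card T) a"
      "\<forall>u. eval_expr (\<lambda>i. if i \<in> u then 0 else v i) f = set_poly L u"
    and L': "\<forall>(T, a)\<in>set L'. long_product (card T) a"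
      "\<forall>u. eval_expr (\<lambda>i. if i \<in> u then 0 else v i) g = set_poly L' u"
    by blast
  show ?case
    by (rule exI[of _ "L @ map (\<lambda>(T, a). (T, - a)) L'"])
      (use L L' in \<open>auto simp: set_poly_append set_poly_map long_product_uminus\<close>)
next
  case (Times f g)
  then obtain L L' where L: "\<forall>(T, a)\<in>set L. long_product (card T) a"
      "\<forall>u. eval_expr (\<lambda>i. if i \<in> u then 0 else v i) f = set_poly L u"
    and L': "\<forall>(T, a)\<in>set L'. long_product (card T) a"
      "\<forall>u. eval_expr (\<lambda>i. if i \<in> u then 0 else v i) g = set_poly L' u"
    by blast
  have "long_product (card (T \<union> T')) (a * b)" if "(T, a) \<in> set L" "(T', b) \<in> set L'" for T T' a b
    using that L(1) L'(1) by (blast intro: long_product_mono[OF long_product_times card_Un_le])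
  then show ?case
    by (intro exI[of _ "concat (map (\<lambda>(T, a). map (\<lambda>(T', b). (T \<union> T', a * b)) L') L)"])
      (use L L' in \<open>auto simp: set_poly_times\<close>)
qed

text \<open>An integer multiplier \<open>e\<close> that acts idempotently is a ring endomorphism, as
  (ex)(ey) = e(e(xy)) = e(xy). So the e-part of a value depends only on the e-parts of the
  variables.\<close>

lemma nmul_eval_expr_cong:
  fixes f :: "'a::ring expr"
  assumes "\<And>x::'a. nmul e (nmul e x) = nmul e x" and "\<And>i. nmul e (v i) = nmul e (w i)"
  shows "nmul e (eval_expr v f) = nmul e (eval_expr w f)"
proof (induction f)
  case (Times f g)
  have "nmul e (x * y) = nmul e x * nmul e y" for x y :: 'a
    using assms(1)[of "x * y"] by (simp add: nmul_times_left nmul_times_right)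
  then show ?case
    using Times by simp
qed (use assms(2) in \<open>simp_all add: nmul_plus nmul_diff\<close>)

text \<open>
  The multiplier \<open>e\<close> projects onto the \<open>p\<close>-component.  A solution with minimal support has small
  support: otherwise, the number of subsets \<open>u\<close> of the support that can be switched off,
  counted with signs, would be divisible by \<open>p\<close>, so that \<open>u = {}\<close> could not be the only one.
\<close>
lemma p_component_small_support:
  fixes f :: "'a::{finite,ring} expr" and p :: nat
  assumes nil: "nilpotent_ring TYPE('a)"
    and p: "prime p" "p ^ k \<le> CARD('a)"
    and e: "\<And>x::'a. nmul (p ^ k) (nmul e x) = 0"
    and fin: "finite {i. v i \<noteq> 0}" and sol: "nmul e (eval_expr v f) = 0"
  shows "\<exists>w. {i. w i \<noteq> 0} \<subseteq> {i. v i \<noteq> 0} \<and> card {i. w i \<noteq> 0} \<le> (CARD('a) - 1) ^ 3 \<and>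
    nmul e (eval_expr w f) = 0"
  using fin sol
proof (induction "card {i. v i \<noteq> 0}" arbitrary: v rule: less_induct)
  case less
  let ?M = "{i. v i \<noteq> 0}"
  let ?d = "CARD('a) - 1"
  show ?case
  proof (cases "card ?M \<le> ?d ^ 3")
    case True
    then show ?thesis
      using less.prems by blast
  next
    case False
    obtain L where L: "\<forall>(T, a)\<in>set L. long_product (card T) a"
      "\<And>u. eval_expr (\<lambda>i. if i \<in> u then 0 else v i) f = set_poly L u"
      using eval_expr_set_poly[of v f] by blast
    \<comment> \<open>Terms with coefficient 0 may have arbitrarily large degree; they are dropped
      before nilpotency bounds the degree by N - 1. Multiplying by \<open>e\<close> moves the
      coefficients into the group annihilated by \<open>p ^ k\<close>.\<close>
    define L' where "L' = map (\<lambda>(T, a). (T, nmul e a)) (filter (\<lambda>(T, a). a \<noteq> 0) L)"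
    have L'_eq: "set_poly L' u = nmul e (eval_expr (\<lambda>i. if i \<in> u then 0 else v i) f)" for u
      unfolding L'_def L(2) by (simp add: set_poly_map set_poly_filter nmul_plus)
    have L': "card T \<le> ?d \<and> a \<in> range (nmul e)" if "(T, a) \<in> set L'" for T a
    proof -
      obtain b where b: "(T, b) \<in> set L" "b \<noteq> 0" "a = nmul e b"
        using \<open>(T, a) \<in> set L'\<close> by (auto simp: L'_def)
      then have "long_product (card T) b"
        using L(1) by blast
      then have "card T < CARD('a)"
        using nilpotent_prod_card[OF nil] b(2) unfolding long_product_def
        by (metis not_le order_trans)
      then show ?thesis
        using b(3) by auto
    qed
    define \<phi> where "\<phi> y = (if y = 0 then 1 else 0 :: int)" for y :: 'a
    have "int p dvd (\<Sum>u | {} \<subseteq> u \<and> u \<subseteq> ?M. (-1) ^ card u * \<phi> (0 + set_poly L' u))"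
    \<comment> \<open>\<open>K\<close> is the least length above (N - 1)^2, as the vanishing of
      iterated differences requires; then \<open>K * d = d ^ 3 + d\<close>, which is where the cubic
      threshold comes from.\<close>
    proof (rule alternating_sum_set_poly[where K = "Suc (?d\<^sup>2)" and d = ?d and A = "range (nmul e)"])
      show "int p dvd fold fdiff as \<phi> y"
        if "length as = Suc (?d\<^sup>2)" "set as \<subseteq> range (nmul e)" for as y
        by (rule fold_fdiff_vanishes[OF p]) (use that e in auto)
      show "Suc (?d\<^sup>2) * ?d < card (?M - {}) + ?d"
      proof -
        have "Suc (?d\<^sup>2) * ?d = ?d ^ 3 + ?d"
          by (simp add: power2_eq_square power3_eq_cube)
        then show ?thesis
          using False by (simp only: Diff_empty not_le add_less_cancel_right)
      qed
    qed (use L' less.prems in auto)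
    then have dvd: "int p dvd (\<Sum>u\<in>Pow ?M. (-1) ^ card u * \<phi> (set_poly L' u))"
      by (simp add: Pow_def)
    have "\<exists>u. u \<subseteq> ?M \<and> u \<noteq> {} \<and> set_poly L' u = 0"
    proof (rule ccontr)
      assume *: "\<not> ?thesis"
      have "(\<Sum>u\<in>Pow ?M. (-1) ^ card u * \<phi> (set_poly L' u)) = (\<Sum>u\<in>{{}}. (-1) ^ card u * \<phi> (set_poly L' u))"
        by (rule sum.mono_neutral_right) (use less.prems * in \<open>auto simp: \<phi>_def\<close>)
      also have "\<dots> = 1"
        using less.prems(2) L'_eq[of "{}"] by (simp add: \<phi>_def)
      finally show False
        using dvd p(1) by (simp add: prime_nat_iff)
    qed
    then obtain u where u: "u \<subseteq> ?M" "u \<noteq> {}" "set_poly L' u = 0"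
      by blast
    let ?w = "\<lambda>i. if i \<in> u then 0 else v i"
    have supp: "{i. ?w i \<noteq> 0} \<subset> ?M"
      using u(1,2) by auto
    then have "card {i. ?w i \<noteq> 0} < card ?M"
      using less.prems(1) by (rule psubset_card_mono[rotated])
    then show ?thesis
      using less.hyps[of ?w] supp less.prems(1) u(3) L'_eq finite_subset
      by (metis (lifting) psubset_imp_subset order_trans)
  qed
qed

section \<open>Assembling a solution from its prime components\<close>

fun vars :: "'a expr \<Rightarrow> nat set" where
  "vars (Var i) = {i}"
| "vars (Const a) = {}"
| "vars (Plus f g) = vars f \<union> vars g"
| "vars (Minus f g) = vars f \<union> vars g"
| "vars (Times f g) = vars f \<union> vars g"

lemma finite_vars: "finite (vars f)"
  by (induction f) simp_all

lemma eval_expr_cong: "(\<And>i. i \<in> vars f \<Longrightarrow> v i = w i) \<Longrightarrow> eval_expr v f = eval_expr w f"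
  by (induction f) simp_all

text \<open>The Chinese remainder theorem for n = q * m with q the full power of p in n: take e
  congruent to 1 modulo q and to 0 modulo m.\<close>

lemma prime_component_multiplier:
  fixes p n :: nat
  assumes "prime p" "n > 0"
  obtains e where "[e = 1] (mod p ^ multiplicity p n)" "n dvd p ^ multiplicity p n * e"
    "\<And>q. prime q \<Longrightarrow> q \<noteq> p \<Longrightarrow> q ^ multiplicity q n dvd e"
proof -
  let ?q = "p ^ multiplicity p n"
  obtain m where m: "n = ?q * m"
    using multiplicity_dvd by blast
  have "\<not> p dvd m"
    using assms m by (metis multiplicity_decompose' dvd_triv_left is_unit_power_iff
        multiplicity_decompose mult_left_cancel nonzero_mult_div_cancel_left not_prime_0
        not_prime_unit gr_implies_not0 mult_not_zero)
  then have cop: "coprime ?q m"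
    using assms(1) by (simp add: prime_imp_coprime)
  obtain e where e: "[e = 1] (mod ?q)" "[e = 0] (mod m)"
    using binary_chinese_remainder_nat[OF cop] by blast
  show ?thesis
  proof (rule that[OF e(1)])
    show "n dvd ?q * e"
      using e(2) by (subst m) (simp add: cong_0_iff)
    fix q :: nat assume q: "prime q" "q \<noteq> p"
    have "q ^ multiplicity q n dvd ?q * m"
      using m multiplicity_dvd by metis
    moreover have "coprime (q ^ multiplicity q n) ?q"
      using q assms(1) by (simp add: primes_coprime)
    ultimately have "q ^ multiplicity q n dvd m"
      by (simp add: coprime_dvd_mult_right_iff)
    then show "q ^ multiplicity q n dvd e"
      using e(2) by (meson cong_0_iff dvd_trans)
  qed
qed

lemma prime_powers_dvd_imp_dvd:
  fixes n m :: nat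
  assumes "n > 0" "\<And>q. prime q \<Longrightarrow> q dvd n \<Longrightarrow> q ^ multiplicity q n dvd m"
  shows "n dvd m"
proof (cases "m = 0")
  case False
  show ?thesis
  proof (rule multiplicity_le_imp_dvd)
    fix q :: nat assume q: "prime q"
    show "multiplicity q n \<le> multiplicity q m"
    proof (cases "q dvd n")
      case True
      then show ?thesis
        using assms(2) q False by (metis multiplicity_geI not_prime_unit)
    next
      case False
      then show ?thesis
        by (simp add: not_dvd_imp_multiplicity_0)
    qed
  qed (use assms in simp)
qed simp

lemma card_prime_factors_le: "n > 0 \<Longrightarrow> card (prime_factors n) \<le> n - 1" for n :: nat
proof -
  assume "n > 0"
  then have "prime_factors n \<subseteq> {2..n}"
    by (auto simp: in_prime_factors_iff prime_ge_2_nat dvd_imp_le)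
  then have "card (prime_factors n) \<le> card {2..n}"
    by (rule card_mono[rotated]) simp
  then show ?thesis
    by simp
qed

text \<open>The multipliers \<open>e p\<close> act as orthogonal idempotents with sum 1. For
  \<open>w\<close> the sum of all \<open>e q\<close> times \<open>W q\<close>, the p-part of
  \<open>w\<close> is that of \<open>W p\<close>, so every p-part of the value of \<open>f\<close>
  at \<open>w\<close> vanishes, and with it the value. The supports of the at most N - 1 many
  \<open>W p\<close> add up.\<close>

lemma solvable_small_support:
  fixes f :: "'a::{finite,ring} expr"
  assumes nil: "nilpotent_ring TYPE('a)" and "solvable f"
  shows "\<exists>w. {i. w i \<noteq> 0} \<subseteq> vars f \<and> card {i. w i \<noteq> 0} \<le> (CARD('a) - 1) ^ 4 \<and> eval_expr w f = 0"
proof -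
  let ?N = "CARD('a)" and ?Q = "prime_factors CARD('a)"
  have N: "?N > 0"
    by simp
  obtain v0 where v0: "eval_expr v0 f = 0"
    using assms(2) unfolding solvable_def by blast
  \<comment> \<open>A solution assigns values to infinitely many variables; clearing those absent
    from \<open>f\<close> makes the support finite.\<close>
  define v where "v i = (if i \<in> vars f then v0 i else 0)" for i
  have v: "eval_expr v f = 0"
    using v0 eval_expr_cong[of f v v0] by (simp add: v_def)
  have v_supp: "{i. v i \<noteq> 0} \<subseteq> vars f"
    by (auto simp: v_def)
  have "\<exists>e. [e = 1] (mod p ^ multiplicity p ?N) \<and> ?N dvd p ^ multiplicity p ?N * e \<and>
      (\<forall>q. prime q \<longrightarrow> q \<noteq> p \<longrightarrow> q ^ multiplicity q ?N dvd e)" if "p \<in> ?Q" for p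
    using prime_component_multiplier[of p ?N] that N by (metis in_prime_factors_imp_prime)
  then obtain e where e: "\<And>p. p \<in> ?Q \<Longrightarrow> [e p = 1] (mod p ^ multiplicity p ?N)"
      "\<And>p. p \<in> ?Q \<Longrightarrow> ?N dvd p ^ multiplicity p ?N * e p"
      "\<And>p q. p \<in> ?Q \<Longrightarrow> prime q \<Longrightarrow> q \<noteq> p \<Longrightarrow> q ^ multiplicity q ?N dvd e p"
    by metis
  have idem: "nmul (e p) (nmul (e p) x) = nmul (e p) x" if p: "p \<in> ?Q" for p and x :: 'a
  proof -
    \<comment> \<open>e(e - 1) is a multiple of e times the p-power of N, which N divides. The
      detour through the integers avoids truncated subtraction.\<close>
    have "[e p * e p = e p] (mod ?N)"
    proof -
      have "[int (e p) * int (e p) = int (e p)] (mod int ?N)"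
      proof -
        obtain c where c: "int (e p) - 1 = int (p ^ multiplicity p ?N) * c"
          using e(1)[OF p] by (metis cong_iff_dvd_diff cong_int_iff dvdE of_nat_1)
        have "int ?N dvd int (p ^ multiplicity p ?N * e p) * c"
          using e(2)[OF p] by (meson dvd_mult2 int_dvd_int_iff)
        also have "int (p ^ multiplicity p ?N * e p) * c = int (e p) * (int (e p) - 1)"
          unfolding c by simp
        finally show ?thesis
          by (simp add: cong_iff_dvd_diff algebra_simps)
      qed
      then show ?thesis
        by (metis cong_int_iff of_nat_mult)
    qed
    then show ?thesis
      unfolding nmul_nmul by (rule nmul_cong)
  qed
  have orth: "nmul (e p) (nmul (e q) x) = 0" if "p \<in> ?Q" "q \<in> ?Q" "p \<noteq> q" for p q and x :: 'a
  proof -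
    have "?N dvd e p * e q"
    proof (rule prime_powers_dvd_imp_dvd[OF N])
      fix r :: nat assume "prime r"
      then show "r ^ multiplicity r ?N dvd e p * e q"
        using e(3) that by (cases "r = p") (auto intro: dvd_mult dvd_mult2)
    qed
    then show ?thesis
      unfolding nmul_nmul by (rule nmul_dvd[OF nmul_card])
  qed
  have "\<exists>w. {i. w i \<noteq> 0} \<subseteq> {i. v i \<noteq> 0} \<and> card {i. w i \<noteq> 0} \<le> (?N - 1) ^ 3 \<and>
      nmul (e p) (eval_expr w f) = 0" if "p \<in> ?Q" for p
  proof (rule p_component_small_support[OF nil])
    show "prime p"
      using that by auto
    show "p ^ multiplicity p ?N \<le> ?N"
      by (intro dvd_imp_le multiplicity_dvd N)
    show "nmul (p ^ multiplicity p ?N) (nmul (e p) x) = 0" for x :: 'a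
      unfolding nmul_nmul by (rule nmul_dvd[OF nmul_card e(2)[OF that]])
    show "finite {i. v i \<noteq> 0}"
      using v_supp finite_vars finite_subset by blast
  qed (simp add: v)
  then obtain W where W: "\<And>p. p \<in> ?Q \<Longrightarrow> {i. W p i \<noteq> 0} \<subseteq> {i. v i \<noteq> 0}"
      "\<And>p. p \<in> ?Q \<Longrightarrow> card {i. W p i \<noteq> 0} \<le> (?N - 1) ^ 3"
      "\<And>p. p \<in> ?Q \<Longrightarrow> nmul (e p) (eval_expr (W p) f) = 0"
    by metis
  define w where "w i = (\<Sum>q\<in>?Q. nmul (e q) (W q i))" for i
  have supp: "{i. w i \<noteq> 0} \<subseteq> (\<Union>q\<in>?Q. {i. W q i \<noteq> 0})"
    by (auto simp: w_def) (metis (mono_tags, lifting) nmul_zero sum.neutral)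
  have 1: "{i. w i \<noteq> 0} \<subseteq> vars f"
    using supp W(1) v_supp by blast
  have "card {i. w i \<noteq> 0} \<le> card (\<Union>q\<in>?Q. {i. W q i \<noteq> 0})"
    using supp W(1) v_supp finite_vars finite_subset
    by (intro card_mono) (auto intro!: finite_subset[OF _ finite_vars[of f]])
  also have "\<dots> \<le> (\<Sum>q\<in>?Q. card {i. W q i \<noteq> 0})"
    by (rule card_UN_le) simp
  also have "\<dots> \<le> card ?Q * (?N - 1) ^ 3"
    using sum_bounded_above[of ?Q "\<lambda>q. card {i. W q i \<noteq> 0}" "(?N - 1) ^ 3"] W(2) by simp
  also have "\<dots> \<le> (?N - 1) * (?N - 1) ^ 3"
    using card_prime_factors_le[OF N] by (rule mult_right_mono) simp
  finally have 2: "card {i. w i \<noteq> 0} \<le> (?N - 1) ^ 4"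
    by (simp add: numeral_eq_Suc)
  let ?y = "eval_expr w f"
  have y: "nmul (e p) ?y = 0" if "p \<in> ?Q" for p
  proof -
    have "nmul (e p) (w i) = nmul (e p) (W p i)" for i
    proof -
      have "nmul (e p) (w i) = (\<Sum>q\<in>?Q. nmul (e p) (nmul (e q) (W q i)))"
        by (simp add: w_def nmul_sum)
      also have "\<dots> = (\<Sum>q\<in>{p}. nmul (e p) (nmul (e q) (W q i)))"
        by (rule sum.mono_neutral_right) (use that orth in auto)
      finally show ?thesis
        using idem[OF that] by simp
    qed
    then show ?thesis
      using nmul_eval_expr_cong[OF idem[OF that], of w "W p" f] W(3)[OF that] by simp
  qed
  \<comment> \<open>Modulo the q-power of N, the summand \<open>e q\<close> is 1 and all others are
    0.\<close>
  have "[(\<Sum>p\<in>?Q. e p) = 1] (mod ?N)"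
  proof -
    have "?N dvd nat \<bar>int (\<Sum>p\<in>?Q. e p) - 1\<bar>"
    proof (rule prime_powers_dvd_imp_dvd[OF N])
      fix q :: nat assume q: "prime q" "q dvd ?N"
      then have qQ: "q \<in> ?Q"
        using N by (simp add: in_prime_factors_iff)
      let ?m = "q ^ multiplicity q ?N"
      have "[(\<Sum>p\<in>?Q. e p) = (\<Sum>p\<in>?Q. if p = q then 1 else 0)] (mod ?m)"
        using e(1)[OF qQ] e(3) q by (intro cong_sum) (auto simp: cong_0_iff)
      then have "[(\<Sum>p\<in>?Q. e p) = 1] (mod ?m)"
        using qQ by simp
      then have "int ?m dvd int (\<Sum>p\<in>?Q. e p) - 1"
        by (metis cong_iff_dvd_diff cong_int_iff of_nat_1)
      then show "?m dvd nat \<bar>int (\<Sum>p\<in>?Q. e p) - 1\<bar>"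
        by (metis dvd_abs_iff int_dvd_int_iff int_nat_eq abs_ge_zero)
    qed
    then have "int ?N dvd int (\<Sum>p\<in>?Q. e p) - 1"
      by (simp add: dvd_nat_abs_iff)
    then show ?thesis
      by (metis cong_iff_dvd_diff cong_int_iff of_nat_1)
  qed
  then have "nmul (\<Sum>p\<in>?Q. e p) ?y = nmul 1 ?y"
    by (rule nmul_cong)
  moreover have "nmul (\<Sum>p\<in>A. e p) ?y = (\<Sum>p\<in>A. nmul (e p) ?y)" if "finite A" for A
    using that by induction (simp_all add: nmul_add)
  ultimately have "?y = 0"
    using y by simp
  then show ?thesis
    using 1 2 by blast
qed

section \<open>Programs for the random access machine\<close>

definition code_at :: "instr list \<Rightarrow> nat \<Rightarrow> instr list \<Rightarrow> bool" where
  "code_at P pc cs \<longleftrightarrow> (\<exists>xs ys. P = xs @ cs @ ys \<and> length xs = pc)"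

lemma code_at_append:
  "code_at P pc (xs @ ys) \<Longrightarrow> code_at P pc xs \<and> code_at P (pc + length xs) ys"
  unfolding code_at_def
proof (elim exE conjE, intro conjI)
  fix us vs assume P: "P = us @ (xs @ ys) @ vs" "length us = pc"
  show "\<exists>us vs. P = us @ xs @ vs \<and> length us = pc"
    by (rule exI[of _ us], rule exI[of _ "ys @ vs"]) (simp add: P)
  show "\<exists>us vs. P = us @ ys @ vs \<and> length us = pc + length xs"
    by (rule exI[of _ "us @ xs"], rule exI[of _ vs]) (simp add: P)
qed

lemma code_at_Cons:
  assumes "code_at P pc (i # cs)"
  shows "pc < length P" "P ! pc = i" "code_at P (Suc pc) cs"
proof -
  show "pc < length P" "P ! pc = i"
    using assms unfolding code_at_def by auto
  show "code_at P (Suc pc) cs"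
    using code_at_append[of P pc "[i]" cs] assms by simp
qed

definition run :: "instr list \<Rightarrow> nat \<Rightarrow> (nat \<Rightarrow> nat) \<Rightarrow> nat list \<Rightarrow> nat \<Rightarrow>
    ((nat \<Rightarrow> nat) \<Rightarrow> nat list \<Rightarrow> bool) \<Rightarrow> nat \<Rightarrow> bool" where
  "run P pc X w pc' Q K \<longleftrightarrow>
     (\<exists>t\<le>K. \<exists>X' w'. (step P ^^ t) (Running pc X w) = Running pc' X' w' \<and> Q X' w')"

lemma run_refl: "Q X w \<Longrightarrow> run P pc X w pc Q K"
  unfolding run_def by (rule exI[of _ 0]) simp

lemma run_mono:
  "run P pc X w pc' Q K \<Longrightarrow> (\<And>X w. Q X w \<Longrightarrow> Q' X w) \<Longrightarrow> K \<le> K' \<Longrightarrow> run P pc X w pc' Q' K'"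
proof -
  assume *: "run P pc X w pc' Q K" "\<And>X w. Q X w \<Longrightarrow> Q' X w" "K \<le> K'"
  then obtain t X' w' where "t \<le> K" "(step P ^^ t) (Running pc X w) = Running pc' X' w' \<and> Q X' w'"
    unfolding run_def by blast
  then show "run P pc X w pc' Q' K'"
    unfolding run_def using * by (intro exI[of _ t]) auto
qed

lemma run_trans:
  assumes "run P pc X w pc1 (\<lambda>X' w'. run P pc1 X' w' pc2 Q K2) K1"
  shows "run P pc X w pc2 Q (K1 + K2)"
proof -
  obtain t1 X1 w1 t2 X2 w2 where "t1 \<le> K1" "(step P ^^ t1) (Running pc X w) = Running pc1 X1 w1"
    "t2 \<le> K2" "(step P ^^ t2) (Running pc1 X1 w1) = Running pc2 X2 w2" "Q X2 w2"
    using assms unfolding run_def by blast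
  then show ?thesis
    unfolding run_def by (intro exI[of _ "t2 + t1"]) (simp add: funpow_add)
qed

lemma run_step:
  assumes "pc < length P" "exec_instr (P ! pc) pc X w = Running pc1 X1 w1"
    and "run P pc1 X1 w1 pc' Q K"
  shows "run P pc X w pc' Q (Suc K)"
proof -
  have "run P pc X w pc1 (\<lambda>X' w'. run P pc1 X' w' pc' Q K) 1"
    unfolding run_def using assms by (intro exI[of _ 1]) (simp add: run_def)
  from run_trans[OF this] show ?thesis
    by simp
qed

text \<open>A fragment is relocatable code: it is a function of the address at which it is placed.\<close>

type_synonym fragment = "nat \<Rightarrow> instr list"

text \<open>The start state is concrete, not described by a predicate, so the postcondition can
  refer to it. Sequential code is handled by taking the triple of the second fragment as
  postcondition of the first.\<close>

definition triple :: "fragment \<Rightarrow> (nat \<Rightarrow> nat) \<Rightarrow> nat list \<Rightarrow>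
    ((nat \<Rightarrow> nat) \<Rightarrow> nat list \<Rightarrow> bool) \<Rightarrow> nat \<Rightarrow> bool" where
  "triple c X w Q K \<longleftrightarrow>
     (\<forall>P pc. code_at P pc (c pc) \<longrightarrow> run P pc X w (pc + length (c pc)) Q K)"

lemma tripleD:
  "triple c X w Q K \<Longrightarrow> code_at P pc (c pc) \<Longrightarrow> pc' = pc + length (c pc) \<Longrightarrow> run P pc X w pc' Q K"
  unfolding triple_def by blast

lemma triple_mono:
  "triple c X w Q K \<Longrightarrow> (\<And>X w. Q X w \<Longrightarrow> Q' X w) \<Longrightarrow> K \<le> K' \<Longrightarrow> triple c X w Q' K'"
proof -
  assume *: "triple c X w Q K" "\<And>X w. Q X w \<Longrightarrow> Q' X w" "K \<le> K'"
  show "triple c X w Q' K'"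
    unfolding triple_def
  proof (intro allI impI)
    fix P pc assume "code_at P pc (c pc)"
    then have "run P pc X w (pc + length (c pc)) Q K"
      using *(1) by (simp add: tripleD)
    then show "run P pc X w (pc + length (c pc)) Q' K'"
      by (rule run_mono) (use * in auto)
  qed
qed

definition block :: "instr list \<Rightarrow> fragment" where
  "block is pc = is"

text \<open>Symbolic execution of straight-line code by simplification; jumps and halting are ruled
  out.\<close>

fun exec_block :: "instr list \<Rightarrow> (nat \<Rightarrow> nat) \<Rightarrow> nat list \<Rightarrow>
    ((nat \<Rightarrow> nat) \<Rightarrow> nat list \<Rightarrow> bool) \<Rightarrow> bool" where
  "exec_block [] X w Q = Q X w"
| "exec_block (JumpPos l j # is) X w Q = False"
| "exec_block (i # is) X w Q =
     (case exec_instr i 0 X w of Running _ X' w' \<Rightarrow> exec_block is X' w' Q | Halted b \<Rightarrow> False)"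

lemma triple_block:
  "exec_block is X w Q \<Longrightarrow> length is \<le> K \<Longrightarrow> triple (block is) X w Q K"
proof -
  have *: "code_at P pc is \<Longrightarrow> exec_block is X w Q \<Longrightarrow> run P pc X w (pc + length is) Q (length is)" for P pc
  proof (induction "is" arbitrary: X w pc)
    case (Cons i "is")
    note i = code_at_Cons[OF Cons.prems(1)]
    obtain X' w' where step: "exec_instr i pc X w = Running (Suc pc) X' w'" "exec_block is X' w' Q"
      using Cons.prems(2) by (cases i) auto
    have "run P pc X w (Suc pc + length is) Q (Suc (length is))"
      by (rule run_step[OF i(1) _ Cons.IH[OF i(3) step(2)]]) (simp add: i(2) step(1))
    then show ?case
      by simp
  qed (simp add: run_refl)
  show "exec_block is X w Q \<Longrightarrow> length is \<le> K \<Longrightarrow> triple (block is) X w Q K"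
    unfolding triple_def block_def by (auto intro: run_mono[OF *])
qed

definition seq :: "fragment \<Rightarrow> fragment \<Rightarrow> fragment" where
  "seq a b pc = a pc @ b (pc + length (a pc))"

lemma triple_seq:
  assumes "triple a X w (\<lambda>X' w'. triple b X' w' Q K2) K1" "K1 + K2 \<le> K"
  shows "triple (seq a b) X w Q K"
  unfolding triple_def
proof (intro allI impI)
  fix P pc assume "code_at P pc (seq a b pc)"
  then have a: "code_at P pc (a pc)" and b: "code_at P (pc + length (a pc)) (b (pc + length (a pc)))"
    unfolding seq_def using code_at_append by blast+
  have "run P pc X w (pc + length (a pc)) (\<lambda>X' w'. triple b X' w' Q K2) K1"
    using assms(1) a unfolding triple_def by blast
  then have "run P pc X w (pc + length (a pc))
      (\<lambda>X' w'. run P (pc + length (a pc)) X' w' (pc + length (seq a b pc)) Q K2) K1"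
    by (rule run_mono) (use b in \<open>auto elim!: tripleD simp: seq_def\<close>)
  then show "run P pc X w (pc + length (seq a b pc)) Q K"
    using run_mono[OF run_trans _ assms(2)] by blast
qed

text \<open>Register \<open>0\<close> is kept positive, which makes \<open>JumpPos l 0\<close> an unconditional jump.\<close>

definition cond :: "nat \<Rightarrow> fragment \<Rightarrow> fragment \<Rightarrow> fragment" where
  "cond r a b pc =
     (let cb = b (Suc pc); ca = a (pc + 2 + length cb) in
      JumpPos (pc + 2 + length cb) r # cb @ JumpPos (pc + 2 + length cb + length ca) 0 # ca)"

text \<open>Only the code for \<open>b\<close> is followed by the jump on register 0, hence the
  extra demand on its postcondition. The 2 pays for the test and that jump.\<close>

lemma triple_cond:
  assumes "0 < X r \<Longrightarrow> triple a X w Q K"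
    and "X r = 0 \<Longrightarrow> triple b X w (\<lambda>X' w'. 0 < X' 0 \<and> Q X' w') K"
  shows "triple (cond r a b) X w Q (K + 2)"
  unfolding triple_def
proof (intro allI impI)
  fix P pc assume code: "code_at P pc (cond r a b pc)"
  define lb where "lb = length (b (Suc pc))"
  define la where "la = length (a (pc + 2 + lb))"
  have code: "code_at P pc (JumpPos (pc + 2 + lb) r # b (Suc pc) @ JumpPos (pc + 2 + lb + la) 0 # a (pc + 2 + lb))"
    using code by (simp add: cond_def Let_def lb_def la_def)
  note c1 = code_at_Cons[OF code]
  note c2 = code_at_append[OF c1(3)]
  note c3 = code_at_Cons[OF conjunct2[OF c2]]
  have len: "pc + length (cond r a b pc) = pc + 2 + lb + la"
    by (simp add: cond_def Let_def lb_def la_def)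
  show "run P pc X w (pc + length (cond r a b pc)) Q (K + 2)"
  proof (cases "0 < X r")
    case True
    have "run P (pc + 2 + lb) X w (pc + 2 + lb + la) Q K"
      by (rule tripleD[OF assms(1)[OF True]]) (use c3(3) in \<open>simp_all add: la_def lb_def\<close>)
    then have "run P pc X w (pc + 2 + lb + la) Q (Suc K)"
      using c1(1,2) True by (intro run_step[where pc = pc]) auto
    then show ?thesis
      unfolding len by (rule run_mono) auto
  next
    case False
    then have "run P (Suc pc) X w (Suc pc + lb) (\<lambda>X' w'. 0 < X' 0 \<and> Q X' w') K"
      by (intro tripleD[OF assms(2)]) (use c2 in \<open>simp_all add: lb_def\<close>)
    then have "run P (Suc pc) X w (Suc pc + lb) (\<lambda>X' w'. run P (Suc pc + lb) X' w' (pc + 2 + lb + la) Q 1) K"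
    proof (rule run_mono)
      fix X' w' assume "0 < X' 0 \<and> Q X' w'"
      then show "run P (Suc pc + lb) X' w' (pc + 2 + lb + la) Q 1"
        unfolding One_nat_def using c3(1,2) by (intro run_step[where K = 0]) (auto simp: lb_def intro: run_refl)
    qed simp
    then have "run P (Suc pc) X w (pc + 2 + lb + la) Q (K + 1)"
      by (rule run_trans)
    then have "run P pc X w (pc + 2 + lb + la) Q (Suc (K + 1))"
      using c1(1,2) False by (intro run_step[where pc = pc]) auto
    then show ?thesis
      unfolding len by simp
  qed
qed

definition loop :: "nat \<Rightarrow> fragment \<Rightarrow> fragment" where
  "loop r a pc =
     JumpPos (Suc pc + length (a (Suc pc))) 0 # a (Suc pc) @ [JumpPos (Suc pc) r]"

text \<open>The invariant is indexed by the number of remaining rounds. The test stands behind the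
  body and is reached first by a jump: one test per round, plus the entering jump and the final
  failing test.\<close>

lemma triple_loop:
  assumes "I m X w" "0 < X 0"
    and guard: "\<And>m X w. I m X w \<Longrightarrow> 0 < X r \<longleftrightarrow> 0 < m"
    and body: "\<And>m X w. I (Suc m) X w \<Longrightarrow> triple a X w (I m) K"
    and K': "m * (K + 1) + 2 \<le> K'"
  shows "triple (loop r a) X w (I 0) K'"
  unfolding triple_def
proof (intro allI impI)
  fix P pc assume code: "code_at P pc (loop r a pc)"
  define la where "la = length (a (Suc pc))"
  note c1 = code_at_Cons[OF code[unfolded loop_def]]
  note c2 = code_at_append[OF c1(3)]
  note c3 = code_at_Cons[OF conjunct2[OF c2]]
  have test: "run P (Suc pc + la) X w (pc + 2 + la) (I 0) (m * (K + 1) + 1)" if "I m X w" for X w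
    using that
  proof (induction m arbitrary: X w)
    case 0
    then have "run P (Suc pc + la) X w (pc + 2 + la) (I 0) (Suc 0)"
      using c3(1,2) guard[OF 0] by (intro run_step[where K = 0]) (auto simp: la_def intro: run_refl)
    then show ?case
      by simp
  next
    case (Suc m)
    have "run P (Suc pc) X w (Suc pc + la) (I m) K"
      by (rule tripleD[OF body[OF Suc.prems]]) (use c2 in \<open>simp_all add: la_def\<close>)
    then have "run P (Suc pc) X w (Suc pc + la)
        (\<lambda>X' w'. run P (Suc pc + la) X' w' (pc + 2 + la) (I 0) (m * (K + 1) + 1)) K"
      by (rule run_mono) (use Suc.IH in auto)
    then have "run P (Suc pc) X w (pc + 2 + la) (I 0) (K + (m * (K + 1) + 1))"
      by (rule run_trans)
    then have "run P (Suc pc + la) X w (pc + 2 + la) (I 0) (Suc (K + (m * (K + 1) + 1)))"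
      using c3(1,2) guard[OF Suc.prems] by (intro run_step[where pc = "Suc pc + la"]) (auto simp: la_def)
    then show ?case
      by (simp add: add_ac)
  qed
  have "run P pc X w (pc + 2 + la) (I 0) (Suc (m * (K + 1) + 1))"
    using c1(1,2) assms(2) test[OF assms(1)]
    by (intro run_step[where pc = pc]) (auto simp: la_def)
  then show "run P pc X w (pc + length (loop r a pc)) (I 0) K'"
    using K' by (auto simp: loop_def la_def intro: run_mono)
qed

text \<open>The machine has no computed jump, so a case distinction is a chain of tests and
  decrements. The selected case starts with \<open>r\<close> at 0, the default with the excess over
  the number of cases.\<close>

primrec switch :: "nat \<Rightarrow> fragment list \<Rightarrow> fragment \<Rightarrow> fragment" where
  "switch r [] b = b"
| "switch r (c # cs) b = cond r (seq (block [SubReg r r 0]) (switch r cs b)) c"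

lemma triple_switch:
  assumes "X 0 = 1" "r \<noteq> 0" and Q: "\<And>X w. Q X w \<Longrightarrow> 0 < X 0"
    and "X r < length cs \<Longrightarrow> triple (cs ! X r) (X(r := 0)) w Q K"
    and "length cs \<le> X r \<Longrightarrow> triple b (X(r := X r - length cs)) w Q K"
  shows "triple (switch r cs b) X w Q (K + 3 * length cs)"
  using assms(1,4,5)
proof (induction cs arbitrary: X)
  case Nil
  then show ?case
    by simp
next
  case (Cons c cs)
  have "triple (cond r (seq (block [SubReg r r 0]) (switch r cs b)) c) X w Q (K + 3 * length cs + 1 + 2)"
  proof (rule triple_cond)
    assume X: "0 < X r"
    let ?Y = "X(r := X r - 1)"
    have Y: "?Y(r := k) = X(r := k)" for k
      by simp
    have "triple (switch r cs b) ?Y w Q (K + 3 * length cs)"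
    proof (rule Cons.IH)
      show "triple (cs ! ?Y r) (?Y(r := 0)) w Q K" if "?Y r < length cs"
      proof -
        have "X r < length (c # cs)" "(c # cs) ! X r = cs ! ?Y r"
          using that X by (auto simp: nth_Cons')
        then show ?thesis
          unfolding Y using Cons.prems(2) by metis
      qed
      show "triple b (?Y(r := ?Y r - length cs)) w Q K" if "length cs \<le> ?Y r"
      proof -
        have "length (c # cs) \<le> X r" "X r - length (c # cs) = ?Y r - length cs"
          using that X by auto
        then show ?thesis
          unfolding Y using Cons.prems(3) by metis
      qed
    qed (use Cons.prems(1) assms(2) in simp)
    then show "triple (seq (block [SubReg r r 0]) (switch r cs b)) X w Q (K + 3 * length cs + 1)"
      by (intro triple_seq[where ?K1.0 = 1 and ?K2.0 = "K + 3 * length cs"] triple_block)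
        (simp_all add: Cons.prems(1))
  next
    assume X: "X r = 0"
    then have "X(r := 0) = X"
      by auto
    then show "triple c X w (\<lambda>X' w'. 0 < X' 0 \<and> Q X' w') (K + 3 * length cs + 1)"
      using Cons.prems(2) X Q by (auto intro: triple_mono)
  qed
  then show ?case
    unfolding switch.simps by (rule triple_mono) auto
qed

text \<open>Each pair is a counter with the register holding its bound. Counters run from the bound
  down to 1; adding register 14, which is 0, copies a register.\<close>

primrec nest :: "(nat \<times> nat) list \<Rightarrow> fragment \<Rightarrow> fragment" where
  "nest [] b = b"
| "nest (l # ls) b = seq (block [AddReg (fst l) (snd l) 14])
     (loop (fst l) (seq (nest ls b) (block [SubReg (fst l) (fst l) 0])))"

text \<open>\<open>U\<close> is a register state that the innermost body may meet, specified only on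
  the registers \<open>A\<close> that the body preserves.\<close>

definition in_range :: "nat set \<Rightarrow> (nat \<times> nat) list \<Rightarrow> (nat \<Rightarrow> nat) \<Rightarrow> (nat \<Rightarrow> nat) \<Rightarrow> bool" where
  "in_range A ls X U \<longleftrightarrow> (\<forall>r\<in>A - fst ` set ls. U r = X r) \<and>
     (\<forall>l\<in>set ls. 0 < U (fst l) \<and> U (fst l) \<le> X (snd l))"

text \<open>Exhaustive search: the flag in register 2 accumulates the disjunction of
  \<open>F\<close> over all counter values. It stays meaningful because \<open>F\<close> depends
  only on registers the body preserves.\<close>

lemma triple_nest:
  assumes body: "\<And>X w. Good X \<Longrightarrow>
      triple b X w (\<lambda>X' w'. (\<forall>r\<in>A. X' r = X r) \<and> (0 < X' 2 \<longleftrightarrow> 0 < X 2 \<or> F X)) B"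
    and F: "\<And>X Y. (\<And>r. r \<in> A \<Longrightarrow> X r = Y r) \<Longrightarrow> F X = F Y"
    and A: "0 \<in> A" "14 \<in> A" "2 \<notin> A" and "0 < B"
    and "distinct (map fst ls)" "fst ` set ls \<subseteq> A" "snd ` set ls \<subseteq> A"
    and "fst ` set ls \<inter> (snd ` set ls \<union> {0, 14}) = {}"
    and "\<And>U. in_range A ls X U \<Longrightarrow> Good U" "X 0 = 1" "X 14 = 0" "\<forall>l\<in>set ls. 0 < X (snd l)"
  shows "triple (nest ls b) X w
    (\<lambda>X' w'. (\<forall>r\<in>A - fst ` set ls. X' r = X r) \<and>
      (0 < X' 2 \<longleftrightarrow> 0 < X 2 \<or> (\<exists>U. in_range A ls X U \<and> F U)))
    (B * prod_list (map (\<lambda>l. 6 * X (snd l)) ls))"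
  using assms(7-)
proof (induction ls arbitrary: X w)
  case Nil
  have "Good X"
    using Nil.prems by (simp add: in_range_def)
  moreover have "(\<exists>U. in_range A [] X U \<and> F U) \<longleftrightarrow> F X"
  proof -
    have "in_range A [] X X"
      by (simp add: in_range_def)
    moreover have "F U = F X" if "in_range A [] X U" for U
      by (rule F) (use that in \<open>simp add: in_range_def\<close>)
    ultimately show ?thesis
      by blast
  qed
  ultimately show ?case
    using body[of X w] by simp
next
  case (Cons l ls)
  obtain r q where l: "l = (r, q)"
    by (cases l)
  let ?K = "B * prod_list (map (\<lambda>l. 6 * X (snd l)) ls)"
  have "6 * X (snd k) \<noteq> 0" if "k \<in> set ls" for k
    using that Cons.prems(8) by simp
  then have "0 \<notin> set (map (\<lambda>l. 6 * X (snd l)) ls)"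
    by (metis (no_types, lifting) imageE list.set_map)
  then have K: "?K \<noteq> 0"
    using \<open>0 < B\<close> by (simp only: prod_list_zero_iff mult_eq_0_iff) simp
  have r: "r \<in> A" "r \<notin> fst ` set ls" "r \<notin> snd ` set ls" "r \<noteq> 0" "r \<noteq> 14" "r \<noteq> q" "r \<noteq> 2" "0 < X q"
    and q: "q \<in> A" "q \<notin> fst ` set ls"
    using Cons.prems A by (auto simp: l)
  have r2: "2 \<notin> fst ` set ls"
    using Cons.prems(2) A by auto
  have ls: "distinct (map fst ls)" "fst ` set ls \<subseteq> A" "snd ` set ls \<subseteq> A"
    "fst ` set ls \<inter> (snd ` set ls \<union> {0, 14}) = {}"
    using Cons.prems(1-4) by auto
  \<comment> \<open>With \<open>m\<close> values still to try, the flag accounts for exactly those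
    \<open>U\<close> whose outer counter exceeds \<open>m\<close>.\<close>
  define I where "I m X' w' \<longleftrightarrow> m \<le> X q \<and> X' r = m \<and>
      (\<forall>s\<in>A - insert r (fst ` set ls). X' s = X s) \<and>
      (0 < X' 2 \<longleftrightarrow> 0 < X 2 \<or> (\<exists>U. in_range A (l # ls) X U \<and> m < U r \<and> F U))"
    for m X' and w' :: "nat list"
  have step: "triple (seq (nest ls b) (block [SubReg r r 0])) X' w' (I m) (?K + 1)"
    if I: "I (Suc m) X' w'" for m X' w'
  proof (rule triple_seq[where ?K1.0 = ?K and ?K2.0 = 1])
    have agree: "X' s = X s" if "s \<in> A" "s \<noteq> r" "s \<notin> fst ` set ls" for s
      using I that unfolding I_def by auto
    have bounds: "X' (snd k) = X (snd k)" if "k \<in> set ls" for k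
      using that ls r(3) by (intro agree) auto
    \<comment> \<open>One run of the inner loops covers exactly the slice with outer counter
      \<open>Suc m\<close>, since the decrement comes after the body.\<close>
    have range: "in_range A ls X' U \<longleftrightarrow> in_range A (l # ls) X U \<and> U r = Suc m" for U
    proof
      assume U: "in_range A ls X' U"
      then have "U r = Suc m"
        using r I unfolding in_range_def I_def by simp
      moreover have "U s = X s" if "s \<in> A - fst ` set (l # ls)" for s
        using that U agree unfolding in_range_def l by simp
      moreover have "0 < U (fst k) \<and> U (fst k) \<le> X (snd k)" if "k \<in> set ls" for k
        using that U bounds unfolding in_range_def by metis
      moreover have "Suc m \<le> X q"
        using I unfolding I_def by simp
      ultimately show "in_range A (l # ls) X U \<and> U r = Suc m"
        unfolding in_range_def l by simp
    next
      assume U: "in_range A (l # ls) X U \<and> U r = Suc m"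
      have "U s = X' s" if "s \<in> A - fst ` set ls" for s
        using that U agree I by (cases "s = r") (simp_all add: in_range_def I_def l)
      moreover have "0 < U (fst k) \<and> U (fst k) \<le> X' (snd k)" if "k \<in> set ls" for k
        using that U bounds unfolding in_range_def by simp
      ultimately show "in_range A ls X' U"
        unfolding in_range_def by blast
    qed
    have "triple (nest ls b) X' w'
      (\<lambda>X'' w''. (\<forall>r\<in>A - fst ` set ls. X'' r = X' r) \<and>
        (0 < X'' 2 \<longleftrightarrow> 0 < X' 2 \<or> (\<exists>U. in_range A ls X' U \<and> F U)))
      (B * prod_list (map (\<lambda>l. 6 * X' (snd l)) ls))"
    proof (rule Cons.IH[OF ls])
      show "Good U" if "in_range A ls X' U" for U
        using that range Cons.prems(5) by blast
      show "X' 0 = 1" "X' 14 = 0"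
        using agree[of 0] agree[of 14] A r ls(4) Cons.prems(6,7) by auto
      show "\<forall>l\<in>set ls. 0 < X' (snd l)"
        using bounds Cons.prems(8) by simp
    qed
    moreover have "prod_list (map (\<lambda>l. 6 * X' (snd l)) ls) = prod_list (map (\<lambda>l. 6 * X (snd l)) ls)"
      by (rule arg_cong[where f = prod_list], rule map_cong) (use bounds in auto)
    ultimately show "triple (nest ls b) X' w' (\<lambda>X'' w''. triple (block [SubReg r r 0]) X'' w'' (I m) 1) ?K"
    proof (elim triple_mono)
      fix X'' w''
      assume *: "(\<forall>r\<in>A - fst ` set ls. X'' r = X' r) \<and>
        (0 < X'' 2 \<longleftrightarrow> 0 < X' 2 \<or> (\<exists>U. in_range A ls X' U \<and> F U))"
      have "X'' r = X' r" "X'' 0 = X' 0" "X' 0 = X 0"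
        using * r A ls(4) agree[of 0] by auto
      then have "X'' r = Suc m" "X'' 0 = 1"
        using I Cons.prems(6) unfolding I_def by auto
      moreover have "0 < X'' 2 \<longleftrightarrow> 0 < X 2 \<or> (\<exists>U. in_range A (l # ls) X U \<and> m < U r \<and> F U)"
      proof -
        have "m < U r \<longleftrightarrow> U r = Suc m \<or> Suc m < U r" for U :: "nat \<Rightarrow> nat"
          by auto
        then show ?thesis
          using * I unfolding I_def range by blast
      qed
      moreover have "X'' s = X s" if "s \<in> A" "s \<noteq> r" "s \<notin> fst ` set ls" for s
        using * agree[OF that] that by auto
      ultimately have "I m (X''(r := m)) w''"
        using I r A unfolding I_def by simp
      then show "triple (block [SubReg r r 0]) X'' w'' (I m) 1"
        using \<open>X'' r = Suc m\<close> \<open>X'' 0 = 1\<close> by (intro triple_block) auto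
    qed simp
  qed simp
  have start: "I (X q) (X(r := X q)) w" for w
  proof -
    have "\<not> X q < U r" if "in_range A (l # ls) X U" for U
      using that unfolding in_range_def l by simp
    then show ?thesis
      using r unfolding I_def by auto
  qed
  have "triple (loop r (seq (nest ls b) (block [SubReg r r 0]))) (X(r := X q)) w (I 0)
      (X q * (?K + 1 + 1) + 2)" for w
  proof (rule triple_loop[where I = I and K = "?K + 1", OF start])
    show "0 < (X(r := X q)) 0"
      using r(4) Cons.prems(6) by simp
  qed (use step in \<open>simp_all add: I_def\<close>)
  then have "triple (nest (l # ls) b) X w (I 0) (1 + (X q * (?K + 1 + 1) + 2))"
    unfolding nest.simps l fst_conv snd_conv
    by (intro triple_seq[where ?K1.0 = 1 and ?K2.0 = "X q * (?K + 1 + 1) + 2"] triple_block)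
      (simp_all add: Cons.prems(7))
  then show ?case
  proof (rule triple_mono)
    fix X' w' assume "I 0 X' w'"
    then show "(\<forall>r\<in>A - fst ` set (l # ls). X' r = X r) \<and>
      (0 < X' 2 \<longleftrightarrow> 0 < X 2 \<or> (\<exists>U. in_range A (l # ls) X U \<and> F U))"
    proof -
      have "U r > 0" if "in_range A (l # ls) X U" for U
        using that unfolding in_range_def l by simp
      then show ?thesis
        using \<open>I 0 X' w'\<close> unfolding I_def by (auto simp: l)
    qed
  next
    obtain k where k: "?K = Suc k"
      using K not0_implies_Suc by blast
    obtain x where x: "X q = Suc x"
      using r(8) not0_implies_Suc by blast
    show "1 + (X q * (?K + 1 + 1) + 2) \<le> B * prod_list (map (\<lambda>l. 6 * X (snd l)) (l # ls))"
    proof -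
      \<comment> \<open>With x = \<open>X q\<close> and K both at least 1, xK + 2x + 3 is at most xK
        + 2xK + 3xK; this is the source of the factor 6.\<close>
      have "1 + (X q * (?K + 1 + 1) + 2) \<le> 6 * X q * ?K"
        unfolding k x by (simp add: algebra_simps)
      then show ?thesis
        by (simp add: l mult_ac)
    qed
  qed
qed

section \<open>The search machine\<close>

text \<open>Reference semantics for the machine code. The second operand is on top of the stack;
  \<open>None\<close> marks underflow or the token 0, which an encoded expression never
  causes.\<close>

fun token_step :: "('a::ring \<Rightarrow> nat) \<Rightarrow> (nat \<Rightarrow> 'a) \<Rightarrow> nat \<Rightarrow> 'a list \<Rightarrow> 'a list option" where
  "token_step num v z st =
     (if z < 4 then
        (case st of
           b # a # st' \<Rightarrow>
             (if z = 1 then Some ((a + b) # st')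
              else if z = 2 then Some ((a - b) # st')
              else if z = 3 then Some ((a * b) # st')
              else None)
         | _ \<Rightarrow> None)
      else if z < 4 + CARD('a) then Some (inv num (z - 4) # st)
      else Some (v (z - 4 - CARD('a)) # st))"

declare token_step.simps [simp del]

primrec run_tokens :: "('a::ring \<Rightarrow> nat) \<Rightarrow> (nat \<Rightarrow> 'a) \<Rightarrow> nat list \<Rightarrow> 'a list \<Rightarrow> 'a list option" where
  "run_tokens num v [] st = Some st"
| "run_tokens num v (z # zs) st = Option.bind (token_step num v z st) (run_tokens num v zs)"

lemma run_tokens_append:
  "run_tokens num v (xs @ ys) st = Option.bind (run_tokens num v xs st) (run_tokens num v ys)"
  by (induction xs arbitrary: st) (auto split: bind_splits)

lemma run_tokens_encode_expr:
  fixes f :: "'a::{finite,ring} expr"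
  assumes "bij_betw num (UNIV :: 'a set) {..<CARD('a)}"
  shows "run_tokens num v (encode_expr num f) st = Some (eval_expr v f # st)"
proof (induction f arbitrary: st)
  case (Const a)
  have "num a < CARD('a)" "inj num"
    using assms by (auto simp: bij_betw_def)
  then show ?case
    by (simp add: token_step.simps)
qed (simp_all add: run_tokens_append token_step.simps)

text \<open>
  Registers: \<open>0\<close> is constantly 1, \<open>1\<close> the input length \<open>n\<close>, \<open>2\<close> the success flag, \<open>3\<close> the constant
  \<open>base d\<close>, \<open>4\<close> the cardinality of the ring, \<open>14\<close> is constantly 0.  The \<open>j\<close>-th choice consists of an
  input position in \<open>{1..n}\<close> and of a ring element, stored with offset 1.  The input occupies the
  cells \<open>base d + 1, \<dots>, base d + n\<close>; the evaluation stack lies above it, with its top in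
  the cell whose address is in register \<open>7\<close>.
\<close>

definition pos_reg :: "nat \<Rightarrow> nat" where "pos_reg j = 15 + 2 * j"
definition val_reg :: "nat \<Rightarrow> nat" where "val_reg j = 16 + 2 * j"
definition base :: "nat \<Rightarrow> nat" where "base d = 15 + 2 * d"

definition elems :: "('a \<Rightarrow> nat) \<Rightarrow> 'a list" where
  "elems num = map (inv num) [0..<CARD('a)]"

definition push :: fragment where
  "push = block [AddReg 7 7 0, Store 7 10]"

text \<open>The operation table is compiled into the program as nested case distinctions; its cost
  is constant because the ring is fixed.\<close>

definition binop :: "('a \<Rightarrow> nat) \<Rightarrow> ('a \<Rightarrow> 'a \<Rightarrow> 'a) \<Rightarrow> fragment" where
  "binop num g = seq (block [Load 11 7, SubReg 7 7 0, Load 10 7, SubReg 7 7 0])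
     (seq (switch 10 (map (\<lambda>a. switch 11 (map (\<lambda>b. block [SetConst 10 (num (g a b))]) (elems num))
       (block [])) (elems num)) (block [])) push)"

text \<open>Scans the choices for the token in register 9, later matches overriding earlier ones and
  0 being the default. The sum of the two truncated differences is the distance of the tokens, so
  register 12 is 0 exactly on a match. The final decrement undoes the offset of stored
  values.\<close>

primrec lookup :: "('a::zero \<Rightarrow> nat) \<Rightarrow> nat \<Rightarrow> fragment" where
  "lookup num 0 = block [SetConst 10 (num 0)]"
| "lookup num (Suc j) = seq (lookup num j)
     (seq (block [AddReg 12 3 (pos_reg j), Load 12 12, SubReg 13 9 12, SubReg 12 12 9, AddReg 12 12 13])
       (cond 12 (block []) (block [SubReg 10 (val_reg j) 0])))"

text \<open>The empty block for token 0 aligns case numbers with tokens. The switch destroys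
  register 8, so the lookup relies on the copy in register 9.\<close>

definition process_token :: "('a::ring \<Rightarrow> nat) \<Rightarrow> nat \<Rightarrow> fragment" where
  "process_token num d = switch 8
     ([block [], binop num (+), binop num (-), binop num (*)] @
      map (\<lambda>a. seq (block [SetConst 10 (num a)]) push) (elems num))
     (seq (lookup num d) push)"

definition evaluate :: "('a::ring \<Rightarrow> nat) \<Rightarrow> nat \<Rightarrow> fragment" where
  "evaluate num d = seq (block [AddReg 6 1 14, AddReg 5 3 14, AddReg 7 3 1])
     (seq (loop 6 (seq (block [AddReg 5 5 0, Load 8 5, AddReg 9 8 14, SubReg 6 6 0]) (process_token num d)))
       (seq (block [Load 10 7])
         (switch 10 (map (\<lambda>a. block (if a = 0 then [SetConst 2 1] else [])) (elems num)) (block []))))"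

text \<open>A variable is named by an input position rather than by its index, so each choice ranges
  over n positions and N values however large the indices are.\<close>

definition choices :: "nat \<Rightarrow> (nat \<times> nat) list" where
  "choices d = concat (map (\<lambda>j. [(pos_reg j, 1), (val_reg j, 4)]) [0..<d])"

text \<open>All tokens are positive, so the 0 read past the end terminates the loop.\<close>

definition read_input :: "nat \<Rightarrow> nat \<Rightarrow> fragment" where
  "read_input N d = seq (block [SetConst 0 1, SetConst 3 (base d), SetConst 4 N, Read 8])
     (loop 8 (block [AddReg 1 1 0, AddReg 5 3 1, Store 5 8, Read 8]))"

definition search :: "('a::ring \<Rightarrow> nat) \<Rightarrow> nat \<Rightarrow> fragment" where
  "search num d = seq (read_input (CARD('a)) d) (nest (choices d) (evaluate num d))"

definition decider :: "('a::ring \<Rightarrow> nat) \<Rightarrow> nat \<Rightarrow> instr list" where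
  "decider num d = search num d 0 @ [JumpPos (length (search num d 0) + 2) 2, Reject, Accept]"

text \<open>The functional counterpart of \<open>lookup\<close>. Repeated positions, or positions of
  operators, do no harm: every \<open>U\<close> still yields a genuine assignment, so acceptance is
  always sound.\<close>

primrec chosen_value :: "('a::zero \<Rightarrow> nat) \<Rightarrow> nat list \<Rightarrow> (nat \<Rightarrow> nat) \<Rightarrow> nat \<Rightarrow> nat \<Rightarrow> 'a" where
  "chosen_value num toks U 0 z = 0"
| "chosen_value num toks U (Suc j) z =
     (if toks ! (U (pos_reg j) - 1) = z then inv num (U (val_reg j) - 1)
      else chosen_value num toks U j z)"

lemma set_choices: "set (choices d) = (\<Union>j<d. {(pos_reg j, 1), (val_reg j, 4)})"
  by (auto simp: choices_def)

section \<open>Correctness of the search program\<close>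

locale search_machine =
  fixes num :: "'a::{finite,ring} \<Rightarrow> nat" and d :: nat and toks :: "nat list"
  assumes num: "bij_betw num (UNIV :: 'a set) {..<CARD('a)}"
begin

abbreviation n where "n \<equiv> length toks"

definition input_ok :: "(nat \<Rightarrow> nat) \<Rightarrow> bool" where
  "input_ok X \<longleftrightarrow> X 0 = 1 \<and> X 1 = n \<and> X 3 = base d \<and> X 4 = CARD('a) \<and> X 14 = 0 \<and>
     (\<forall>q<n. X (base d + 1 + q) = toks ! q)"

definition good :: "(nat \<Rightarrow> nat) \<Rightarrow> bool" where
  "good X \<longleftrightarrow> input_ok X \<and>
     (\<forall>j<d. 0 < X (pos_reg j) \<and> X (pos_reg j) \<le> n \<and> 0 < X (val_reg j) \<and> X (val_reg j) \<le> CARD('a))"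

text \<open>The registers that an evaluation must leave alone: constants, choices and input cells.
  The flag in register 2 is excluded because a successful evaluation sets it.\<close>

definition kept :: "nat set" where
  "kept = {0, 1, 3, 4} \<union> {14..base d + n}"

text \<open>The stack grows upwards in memory while its list has the top first, hence
  \<open>rev st\<close>. \<open>X0\<close> is the state at the start of the evaluation,
  \<open>p\<close> the last input address read and \<open>c\<close> the number of tokens
  left.\<close>

definition eval_state :: "(nat \<Rightarrow> nat) \<Rightarrow> nat \<Rightarrow> nat \<Rightarrow> 'a list \<Rightarrow> (nat \<Rightarrow> nat) \<Rightarrow> bool" where
  "eval_state X0 p c st X \<longleftrightarrow> (\<forall>r\<in>insert 2 kept. X r = X0 r) \<and> X 5 = p \<and> X 6 = c \<and>
     X 7 = base d + n + length st \<and>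
     (\<forall>i<length st. X (base d + n + 1 + i) = num (rev st ! i))"

lemma num_less: "num a < CARD('a)"
  using num by (auto simp: bij_betw_def)

lemma inv_num [simp]: "inv num (num a) = a"
  using num by (simp add: bij_betw_def)

lemma num_inv: "k < CARD('a) \<Longrightarrow> num (inv num k) = k"
  using num by (intro f_inv_into_f) (auto simp: bij_betw_def)

lemma length_elems [simp]: "length (elems num) = CARD('a)"
  by (simp add: elems_def)

lemma nth_elems [simp]: "elems num ! num a = a"
  using num_less[of a] by (simp add: elems_def)

lemma base_ge: "15 \<le> base d"
  by (simp add: base_def)

lemma eval_state_upd:
  assumes "eval_state X0 p c st X" "r \<notin> insert 2 kept" "r \<notin> {5, 6, 7}" "r \<le> 14"
  shows "eval_state X0 p c st (X(r := k))"
  using assms base_ge unfolding eval_state_def by auto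

lemma kept_simps: "8 \<notin> kept" "9 \<notin> kept" "10 \<notin> kept" "11 \<notin> kept" "12 \<notin> kept" "13 \<notin> kept"
    "2 \<notin> kept" "5 \<notin> kept" "6 \<notin> kept" "7 \<notin> kept"
    "0 \<in> kept" "1 \<in> kept" "3 \<in> kept" "4 \<in> kept" "14 \<in> kept"
    "j < d \<Longrightarrow> pos_reg j \<in> kept" "j < d \<Longrightarrow> val_reg j \<in> kept"
    "q < n \<Longrightarrow> base d + 1 + q \<in> kept" "base d + n < r \<Longrightarrow> r \<notin> kept"
  by (auto simp: kept_def base_def pos_reg_def val_reg_def)

lemma eval_state_kept: "eval_state X0 p c st X \<Longrightarrow> r \<in> insert 2 kept \<Longrightarrow> X r = X0 r"
  by (auto simp: eval_state_def)

lemma eval_state_one: "eval_state X0 p c st X \<Longrightarrow> input_ok X0 \<Longrightarrow> X 0 = 1"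
  by (simp add: eval_state_kept kept_simps input_ok_def)

lemma triple_push:
  assumes "eval_state X0 p c st X" "X 10 = num a" "input_ok X0"
  shows "triple push X w (\<lambda>X' w'. eval_state X0 p c (a # st) X') 2"
  unfolding push_def
proof (rule triple_block)
  let ?t = "base d + n + length st + 1"
  have "eval_state X0 p c (a # st) (X(7 := ?t, ?t := num a))"
    using assms base_ge kept_simps(2,10,19) unfolding eval_state_def
    by (auto simp: nth_append less_Suc_eq)
  then show "exec_block [AddReg 7 7 0, Store 7 10] X w (\<lambda>X' w'. eval_state X0 p c (a # st) X')"
  proof -
    have "X 7 + X 0 = ?t"
      using assms(1) eval_state_one[OF assms(1,3)] by (simp add: eval_state_def)
    then show ?thesis
      using \<open>eval_state X0 p c (a # st) _\<close> assms(2) by simp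
  qed
qed simp

lemma triple_binop:
  assumes X: "eval_state X0 p c (b # a # st) X" and X0: "input_ok X0"
  shows "triple (binop num g) X w (\<lambda>X' w'. eval_state X0 p c (g a b # st) X') (6 * CARD('a) + 7)"
  unfolding binop_def
proof (rule triple_seq[where ?K1.0 = 4 and ?K2.0 = "6 * CARD('a) + 3"])
  let ?cells = "\<lambda>a. map (\<lambda>b. block [SetConst 10 (num (g a b))]) (elems num)"
  let ?row = "\<lambda>a. switch 11 (?cells a) (block [])"
  let ?table = "switch 10 (map ?row (elems num)) (block [])"
  note one = eval_state_one[OF _ X0]
  let ?X = "X(11 := num b, 7 := base d + n + length st, 10 := num a)"
  have top: "X 7 = base d + n + length st + 2" "X (base d + n + length st + 2) = num b"
      "X (base d + n + length st + 1) = num a"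
    using X unfolding eval_state_def by (auto simp: nth_append)
  have st: "eval_state X0 p c st ?X"
    using X base_ge kept_simps(3,4,10) unfolding eval_state_def
    by (auto simp: nth_append)
  have inner: "triple (?row a) (?X(10 := 0)) w (\<lambda>X' w'. eval_state X0 p c st X' \<and> X' 10 = num (g a b)) (1 + 3 * CARD('a))"
  proof -
    have "triple (?row a) (?X(10 := 0)) w (\<lambda>X' w'. eval_state X0 p c st X' \<and> X' 10 = num (g a b))
      (1 + 3 * length (?cells a))"
    proof (rule triple_switch)
      have "eval_state X0 p c st ((?X(10 := 0))(11 := 0, 10 := num (g a b)))"
        by (intro eval_state_upd st) (simp_all add: kept_simps)
      then show "triple (map (\<lambda>b. block [SetConst 10 (num (g a b))]) (elems num) ! (?X(10 := 0)) 11)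
        ((?X(10 := 0))(11 := 0)) w (\<lambda>X' w'. eval_state X0 p c st X' \<and> X' 10 = num (g a b)) 1"
        using num_less[of b] by (simp add: triple_block)
      show "(?X(10 := 0)) 0 = 1"
        using one[OF st] by simp
      show "0 < X' 0" if "eval_state X0 p c st X' \<and> X' 10 = num (g a b)" for X'
        using one[of p c st X'] that by simp
    qed (use num_less[of b] in simp_all)
    then show ?thesis
      by simp
  qed
  have "triple (seq ?table push) ?X w (\<lambda>X' w'. eval_state X0 p c (g a b # st) X') (6 * CARD('a) + 3)"
  proof (rule triple_seq[where ?K1.0 = "6 * CARD('a) + 1" and ?K2.0 = 2])
    have "triple ?table ?X w (\<lambda>X' w'. eval_state X0 p c st X' \<and> X' 10 = num (g a b))
       (1 + 3 * CARD('a) + 3 * length (map ?row (elems num)))"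
    proof (rule triple_switch)
      show "?X 0 = 1"
        using one[OF st] .
      show "0 < X' 0" if "eval_state X0 p c st X' \<and> X' 10 = num (g a b)" for X'
        using one[of p c st X'] that by simp
    qed (use inner num_less[of a] in simp_all)
    then show "triple ?table ?X w
       (\<lambda>X' w'. triple push X' w' (\<lambda>X' w'. eval_state X0 p c (g a b # st) X') 2) (6 * CARD('a) + 1)"
      by (rule triple_mono) (auto intro: triple_push X0)
  qed simp
  then show "triple (block [Load 11 7, SubReg 7 7 0, Load 10 7, SubReg 7 7 0]) X w
     (\<lambda>X' w'. triple (seq ?table push) X' w' (\<lambda>X' w'. eval_state X0 p c (g a b # st) X') (6 * CARD('a) + 3)) 4"
    using top one[OF X] base_ge by (intro triple_block) (simp_all add: fun_upd_twist)
qed simp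

lemma triple_lookup:
  assumes X: "eval_state X0 p c st X" and X0: "good X0" and "j \<le> d"
  shows "triple (lookup num j) X w
    (\<lambda>X' w'. eval_state X0 p c st X' \<and> X' 9 = X 9 \<and>
      X' 10 = num (chosen_value num toks X0 j (X 9))) (8 * j + 1)"
  using \<open>j \<le> d\<close>
proof (induction j)
  case 0
  have "eval_state X0 p c st (X(10 := num 0))"
    by (intro eval_state_upd X) (simp_all add: kept_simps)
  then show ?case
    by (simp add: triple_block)
next
  case (Suc j)
  let ?fetch = "[AddReg 12 3 (pos_reg j), Load 12 12, SubReg 13 9 12, SubReg 12 12 9, AddReg 12 12 13]"
  let ?select = "cond 12 (block []) (block [SubReg 10 (val_reg j) 0])"
  let ?post = "\<lambda>X' (w' :: nat list). eval_state X0 p c st X' \<and> X' 9 = X 9 \<and>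
    X' 10 = num (chosen_value num toks X0 (Suc j) (X 9))"
  let ?z = "toks ! (X0 (pos_reg j) - 1)" and ?y = "X0 (val_reg j) - 1"
  have j: "j < d"
    using Suc.prems by simp
  have ok: "input_ok X0" and range: "0 < X0 (pos_reg j)" "X0 (pos_reg j) \<le> n" "?y < CARD('a)"
    using X0 j unfolding good_def by auto
  have rest: "triple (seq (block ?fetch) ?select) Y w ?post 8"
    if Y: "eval_state X0 p c st Y" "Y 9 = X 9" "Y 10 = num (chosen_value num toks X0 j (X 9))" for Y w
  proof (rule triple_seq[where ?K1.0 = 5 and ?K2.0 = 3])
    let ?Y = "Y(13 := X 9 - ?z, 12 := (?z - X 9) + (X 9 - ?z))"
    have Ykept: "Y r = X0 r" if "r \<in> kept" for r
      using eval_state_kept[OF Y(1)] that by simp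
    have "Y (base d + X0 (pos_reg j)) = ?z"
    proof -
      obtain q where q: "X0 (pos_reg j) = Suc q"
        using range(1) gr0_implies_Suc by blast
      then show ?thesis
        using Ykept[OF kept_simps(18)[of q]] range(2) ok unfolding input_ok_def by simp
    qed
    then have exec: "exec_block ?fetch Y w Q \<longleftrightarrow> Q ?Y w" for Q
      using base_ge Ykept[of 3] Ykept[of "pos_reg j"] kept_simps j ok Y(2)
      by (simp add: input_ok_def fun_upd_twist)
    have "Y 3 = base d" "Y (pos_reg j) = X0 (pos_reg j)" "Y (val_reg j) = X0 (val_reg j)" "Y 0 = 1"
      using Ykept kept_simps j ok unfolding input_ok_def by auto
    have regs: "pos_reg j \<noteq> 12" "val_reg j \<noteq> 12" "val_reg j \<noteq> 13"
      by (simp_all add: pos_reg_def val_reg_def)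
    have st: "eval_state X0 p c st ?Y"
      by (intro eval_state_upd Y) (simp_all add: kept_simps)
    have st2: "eval_state X0 p c st (?Y(10 := k))" for k
      by (intro eval_state_upd st) (simp_all add: kept_simps)
    have "triple ?select ?Y w ?post (1 + 2)"
    proof (rule triple_cond)
      assume "0 < ?Y 12"
      then have "?z \<noteq> X 9"
        by auto
      then show "triple (block []) ?Y w ?post 1"
        using st Y by (intro triple_block) (simp_all del: fun_upd_apply, simp_all)
    next
      assume "?Y 12 = 0"
      then have "?z = X 9"
        by simp
      then show "triple (block [SubReg 10 (val_reg j) 0]) ?Y w (\<lambda>X' w'. 0 < X' 0 \<and> eval_state X0 p c st X' \<and> X' 9 = X 9 \<and>
         X' 10 = num (chosen_value num toks X0 (Suc j) (X 9))) 1"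
        using st2[of ?y] Y regs range \<open>Y 0 = 1\<close> \<open>Y (val_reg j) = X0 (val_reg j)\<close>
        by (intro triple_block) (simp_all add: num_inv)
    qed
    then have "triple ?select ?Y w ?post 3"
      by (rule triple_mono) auto
    then show "triple (block ?fetch) Y w
       (\<lambda>X' w'. triple ?select X' w' ?post 3) 5"
      by (rule triple_block[OF iffD2[OF exec]]) simp
  qed simp
  have "triple (lookup num j) X w
    (\<lambda>X' w'. eval_state X0 p c st X' \<and> X' 9 = X 9 \<and>
      X' 10 = num (chosen_value num toks X0 j (X 9))) (8 * j + 1)"
    using Suc by simp
  then have "triple (lookup num j) X w
    (\<lambda>X' w'. triple (seq (block ?fetch) ?select) X' w' ?post 8) (8 * j + 1)"
  proof (rule triple_mono)
    fix X' w'
    assume "eval_state X0 p c st X' \<and> X' 9 = X 9 \<and> X' 10 = num (chosen_value num toks X0 j (X 9))"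
    then show "triple (seq (block ?fetch) ?select) X' w' ?post 8"
      by (intro rest) auto
  qed simp
  then show ?case
    unfolding lookup.simps by (rule triple_seq) simp
qed

definition assignment :: "(nat \<Rightarrow> nat) \<Rightarrow> nat \<Rightarrow> 'a" where
  "assignment U i = chosen_value num toks U d (4 + CARD('a) + i)"

lemma triple_process_token:
  assumes X: "eval_state X0 p c st X" "X 8 = z" "X 9 = z" and X0: "good X0"
    and st': "token_step num (assignment X0) z st = Some st'"
  shows "triple (process_token num d) X w (\<lambda>X' w'. eval_state X0 p c st' X') (9 * CARD('a) + 8 * d + 24)"
proof -
  have ok: "input_ok X0"
    using X0 by (simp add: good_def)
  let ?ops = "[block [], binop num (+), binop num (-), binop num (*)] :: fragment list"
  let ?pushes = "map (\<lambda>a. seq (block [SetConst 10 (num a)]) push) (elems num)"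
  let ?K = "6 * CARD('a) + 8 * d + 8"
  have upd: "eval_state X0 p c st (X(8 := k))" for k
    by (intro eval_state_upd X) (simp_all add: kept_simps)
  have "triple (process_token num d) X w (\<lambda>X' w'. eval_state X0 p c st' X')
      (?K + 3 * length (?ops @ ?pushes))"
    unfolding process_token_def
  proof (rule triple_switch)
    show "X 0 = 1"
      using eval_state_one[OF X(1) ok] .
    show "0 < X' 0" if "eval_state X0 p c st' X'" for X'
      using eval_state_one[OF that ok] by simp
  next
    assume len: "X 8 < length (?ops @ ?pushes)"
    show "triple ((?ops @ ?pushes) ! X 8) (X(8 := 0)) w (\<lambda>X' w'. eval_state X0 p c st' X') ?K"
    proof (cases "z < 4")
      case True
      then obtain a b st0 where st: "st = b # a # st0"
        using st' by (auto simp: token_step.simps split: list.splits)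
      have "triple (binop num g) (X(8 := 0)) w (\<lambda>X' w'. eval_state X0 p c (g a b # st0) X') ?K" for g
        using triple_binop[OF upd[unfolded st] ok] by (rule triple_mono) auto
      moreover have "z = 1 \<and> st' = (a + b) # st0 \<or> z = 2 \<and> st' = (a - b) # st0 \<or> z = 3 \<and> st' = (a * b) # st0"
        using st' True unfolding st by (auto simp: token_step.simps split: if_splits)
      ultimately show ?thesis
        unfolding X(2) by (elim disjE) (simp_all add: numeral_eq_Suc)
    next
      case False
      then have z: "z - 4 < CARD('a)"
        using len X(2) by simp
      then have z': "z < 4 + CARD('a)"
        by simp
      let ?a = "inv num (z - 4)"
      have "st' = ?a # st"
        using st' False z' by (simp add: token_step.simps)
      have "eval_state X0 p c st ((X(8 := 0))(10 := num ?a))"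
        by (intro eval_state_upd upd) (simp_all add: kept_simps)
      then have "triple (seq (block [SetConst 10 (num ?a)]) push) (X(8 := 0)) w (\<lambda>X' w'. eval_state X0 p c st' X') ?K"
        unfolding \<open>st' = _\<close>
        by (intro triple_seq[where ?K1.0 = 1 and ?K2.0 = 2] triple_block) (auto intro!: triple_push ok)
      moreover have "(?ops @ ?pushes) ! z = seq (block [SetConst 10 (num ?a)]) push"
        using False z by (simp add: nth_append elems_def eval_nat_numeral)
      ultimately show ?thesis
        unfolding X(2) by simp
    qed
  next
    assume len: "length (?ops @ ?pushes) \<le> X 8"
    then have z: "4 + CARD('a) \<le> z"
      using X(2) by simp
    let ?a = "chosen_value num toks X0 d z"
    have st'_eq: "st' = ?a # st"
      using st' z by (simp add: token_step.simps assignment_def)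
    let ?Y = "X(8 := X 8 - length (?ops @ ?pushes))"
    have "triple (lookup num d) ?Y w
      (\<lambda>X' w'. eval_state X0 p c st X' \<and> X' 9 = ?Y 9 \<and> X' 10 = num (chosen_value num toks X0 d (?Y 9))) (8 * d + 1)"
      by (rule triple_lookup[OF upd X0]) simp
    then have "triple (lookup num d) ?Y w (\<lambda>X' w'. triple push X' w' (\<lambda>X' w'. eval_state X0 p c st' X') 2) (8 * d + 1)"
      by (rule triple_mono) (auto intro: triple_push ok simp: st'_eq X(3))
    then show "triple (seq (lookup num d) push) ?Y w (\<lambda>X' w'. eval_state X0 p c st' X') ?K"
      by (rule triple_seq) simp
  qed simp
  then show ?thesis
    by (rule triple_mono) auto
qed

lemma triple_evaluate:
  assumes X0: "good X0" and y: "run_tokens num (assignment X0) toks [] = Some [y]"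
  shows "triple (evaluate num d) X0 w
    (\<lambda>X' w'. (\<forall>r\<in>kept. X' r = X0 r) \<and> (0 < X' 2 \<longleftrightarrow> 0 < X0 2 \<or> y = 0))
    (n * (9 * CARD('a) + 8 * d + 29) + 3 * CARD('a) + 7)"
proof -
  have ok: "input_ok X0"
    using X0 by (simp add: good_def)
  let ?run = "run_tokens num (assignment X0)"
  let ?X = "X0(6 := n, 5 := base d, 7 := base d + n)"
  let ?Kt = "9 * CARD('a) + 8 * d + 24"
  let ?cases = "map (\<lambda>a. block (if a = 0 then [SetConst 2 1] else [])) (elems num)"
  let ?test = "seq (block [Load 10 7]) (switch 10 ?cases (block []))"
  let ?Q = "\<lambda>X' (w' :: nat list). (\<forall>r\<in>kept. X' r = X0 r) \<and>
    (0 < X' 2 \<longleftrightarrow> 0 < X0 2 \<or> y = 0)"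
  define I where "I m X w \<longleftrightarrow> m \<le> n \<and> (\<exists>st. ?run (take (n - m) toks) [] = Some st \<and>
      eval_state X0 (base d + (n - m)) m st X)" for m X and w :: "nat list"
  let ?body = "seq (block [AddReg 5 5 0, Load 8 5, AddReg 9 8 14, SubReg 6 6 0]) (process_token num d)"
  have body: "triple ?body X w (I m) (4 + ?Kt)" if Im: "I (Suc m) X w" for m X w
  proof (rule triple_seq[where ?K1.0 = 4 and ?K2.0 = ?Kt])
    define k where "k = n - Suc m"
    have k: "k < n" "n - m = Suc k" "m \<le> n"
      using Im unfolding I_def k_def by auto
    obtain st where st: "?run (take k toks) [] = Some st" and X: "eval_state X0 (base d + k) (Suc m) st X"
      using Im unfolding I_def k_def by blast
    \<comment> \<open>Success of the complete run forces success on every prefix, so underflow needs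
      no separate treatment.\<close>
    have "?run (take (Suc k) toks @ drop (Suc k) toks) [] = Some [y]"
      using y by simp
    then obtain st' where "?run (take (Suc k) toks) [] = Some st'"
      unfolding run_tokens_append by (metis bind_eq_Some_conv)
    then have st': "?run (take (Suc k) toks) [] = Some st'" "token_step num (assignment X0) (toks ! k) st = Some st'"
      using st k(1) by (auto simp: take_Suc_conv_app_nth run_tokens_append bind_eq_Some_conv)
    let ?Y = "X(5 := base d + Suc k, 8 := toks ! k, 9 := toks ! k, 6 := m)"
    have one: "X 0 = 1" "X 14 = 0"
      using eval_state_one[OF X ok] eval_state_kept[OF X, of 14] kept_simps ok by (auto simp: input_ok_def)
    have tok: "X (Suc (base d + k)) = toks ! k"
      using eval_state_kept[OF X, of "base d + 1 + k"] kept_simps(18)[OF k(1)] ok k(1) by (auto simp: input_ok_def)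
    have Y: "eval_state X0 (base d + Suc k) m st ?Y"
      using X base_ge kept_simps(1,2,8,9) unfolding eval_state_def by auto
    have "triple (process_token num d) ?Y w (\<lambda>X' w'. eval_state X0 (base d + Suc k) m st' X') ?Kt"
      by (rule triple_process_token[OF Y _ _ X0 st'(2)]) simp_all
    then have "triple (process_token num d) ?Y w (I m) ?Kt"
      by (rule triple_mono) (use st'(1) k in \<open>auto simp: I_def\<close>)
    then show "triple (block [AddReg 5 5 0, Load 8 5, AddReg 9 8 14, SubReg 6 6 0]) X w
        (\<lambda>X' w'. triple (process_token num d) X' w' (I m) ?Kt) 4"
      using X one tok base_ge by (intro triple_block) (simp_all add: eval_state_def fun_upd_twist)
  qed simp
  have start: "I n ?X w"
    using base_ge kept_simps(8-10) unfolding I_def eval_state_def by auto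
  have finish: "triple ?test X w ?Q (3 * CARD('a) + 2)"
    if "I 0 X w" for X w
  proof (rule triple_seq[where ?K1.0 = 1 and ?K2.0 = "3 * CARD('a) + 1"])
    have X: "eval_state X0 (base d + n) 0 [y] X"
      using that y unfolding I_def by simp
    have X': "\<forall>r\<in>kept. X r = X0 r" "X 2 = X0 2"
      using eval_state_kept[OF X] by auto
    have "triple (switch 10 ?cases (block [])) (X(10 := num y)) w ?Q (1 + 3 * length ?cases)"
    proof (rule triple_switch)
      show "0 < X' 0" if "?Q X' w'" for X' w'
        using that kept_simps ok unfolding input_ok_def by auto
      have "exec_block (if y = 0 then [SetConst 2 1] else []) (X(10 := 0)) w ?Q"
        using X' kept_simps(3,7) by auto
      then show "triple (?cases ! ((X(10 := num y)) 10)) ((X(10 := num y))(10 := 0)) w ?Q 1"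
        using num_less[of y] by (simp add: triple_block)
    qed (use num_less[of y] eval_state_one[OF X ok] in auto)
    then show "triple (block [Load 10 7]) X w (\<lambda>X' w'. triple (switch 10 ?cases (block [])) X' w' ?Q (3 * CARD('a) + 1)) 1"
      using X by (intro triple_block) (simp_all add: eval_state_def)
  qed simp
  have "triple (loop 6 ?body) ?X w (I 0) (n * (4 + ?Kt + 1) + 2)"
  proof (rule triple_loop[where I = I and K = "4 + ?Kt", OF start])
    show "0 < ?X 0"
      using ok by (simp add: input_ok_def)
    show "0 < X 6 \<longleftrightarrow> 0 < m" if "I m X w" for m X w
      using that by (auto simp: I_def eval_state_def)
  qed (rule body, simp_all)
  then have "triple (loop 6 ?body) ?X w (\<lambda>X w. triple ?test X w ?Q (3 * CARD('a) + 2)) (n * (4 + ?Kt + 1) + 2)"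
    by (rule triple_mono) (use finish in auto)
  then have main: "triple (seq (loop 6 ?body) ?test) ?X w ?Q
      (n * (4 + ?Kt + 1) + 2 + (3 * CARD('a) + 2))"
    by (rule triple_seq) simp
  show ?thesis
    unfolding evaluate_def
  proof (rule triple_seq[where ?K1.0 = 3])
    show "triple (block [AddReg 6 1 14, AddReg 5 3 14, AddReg 7 3 1]) X0 w (\<lambda>X' w'. triple (seq (loop 6 ?body) ?test) X' w' ?Q
      (n * (4 + ?Kt + 1) + 2 + (3 * CARD('a) + 2))) 3"
      using main ok by (intro triple_block) (simp_all add: input_ok_def)
  qed simp
qed

lemma triple_read_input:
  assumes "\<And>z. z \<in> set toks \<Longrightarrow> 0 < z"
  shows "triple (read_input (CARD('a)) d) (\<lambda>_. 0) toks (\<lambda>X' w'. input_ok X' \<and> X' 2 = 0) (5 * n + 6)"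
  unfolding read_input_def
proof (rule triple_seq[where ?K1.0 = 4 and ?K2.0 = "n * (4 + 1) + 2"])
  \<comment> \<open>\<open>m\<close> tokens remain to be stored, the next of which is already in
    register 8; hence the unread input starts one token later.\<close>
  define I where "I m X w \<longleftrightarrow> m \<le> n \<and> X 0 = 1 \<and> X 1 = n - m \<and> X 2 = 0 \<and> X 3 = base d \<and>
      X 4 = CARD('a) \<and> X 14 = 0 \<and> (\<forall>q<n - m. X (base d + 1 + q) = toks ! q) \<and>
      X 8 = (if m = 0 then 0 else toks ! (n - m)) \<and> w = drop (Suc (n - m)) toks"
    for m and X :: "nat \<Rightarrow> nat" and w :: "nat list"
  let ?b = "block [AddReg 1 1 0, AddReg 5 3 1, Store 5 8, Read 8]"
  have body: "triple ?b X w (I m) 4" if I: "I (Suc m) X w" for m X w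
  proof (rule triple_block)
    define k where "k = n - Suc m"
    have k: "n - m = Suc k" "k < n" "m = n - Suc k"
      using I unfolding I_def k_def by auto
    have w: "w = drop (Suc k) toks"
      using I by (simp add: I_def k_def)
    have head: "(case w of [] \<Rightarrow> 0 | a # _ \<Rightarrow> a) = (if m = 0 then 0 else toks ! Suc k)"
      using k by (auto simp: w Cons_nth_drop_Suc[symmetric])
    have tl: "tl w = drop (Suc (Suc k)) toks"
      by (simp add: w drop_Suc tl_drop)
    have X: "X 0 = 1" "X 1 = k" "X 2 = 0" "X 3 = base d" "X 4 = CARD('a)" "X 14 = 0"
        "\<And>q. q < k \<Longrightarrow> X (base d + 1 + q) = toks ! q" "X 8 = toks ! k"
      using I by (auto simp: I_def k_def)
    let ?Y = "X(1 := Suc k, 5 := base d + Suc k, base d + Suc k := toks ! k,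
        8 := (if m = 0 then 0 else toks ! Suc k))"
    have "?Y (base d + 1 + q) = toks ! q" if "q < Suc k" for q
      using that X(7)[of q] base_ge by (cases "q = k") auto
    moreover have "m \<le> n"
      using k by simp
    ultimately have "I m ?Y (tl w)"
      using X(1-6) base_ge unfolding I_def k(1) tl by auto
    then show "exec_block [AddReg 1 1 0, AddReg 5 3 1, Store 5 8, Read 8] X w (I m)"
      using X(1-6,8) base_ge by (simp add: head)
  qed simp
  have guard: "0 < X 8 \<longleftrightarrow> 0 < m" if "I m X w" for m X w
    using that assms[of "toks ! (n - m)"] by (auto simp: I_def)
  have "triple (loop 8 ?b) X w (\<lambda>X' w'. input_ok X' \<and> X' 2 = 0) (n * (4 + 1) + 2)" if "I n X w" for X w
  proof -
    have "triple (loop 8 ?b) X w (I 0) (n * (4 + 1) + 2)"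
    proof (rule triple_loop[where I = I and K = 4, OF that _ guard body])
      show "0 < X 0"
        using that by (simp add: I_def)
    qed simp_all
    then show ?thesis
      by (rule triple_mono) (auto simp: I_def input_ok_def)
  qed
  moreover have "exec_block [SetConst 0 1, SetConst 3 (base d), SetConst 4 CARD('a), Read 8] (\<lambda>_. 0) toks (I n)"
    by (cases toks) (auto simp: I_def)
  ultimately show "triple (block [SetConst 0 1, SetConst 3 (base d), SetConst 4 CARD('a), Read 8]) (\<lambda>_. 0) toks
      (\<lambda>X' w'. triple (loop 8 ?b) X' w' (\<lambda>X' w'. input_ok X' \<and> X' 2 = 0) (n * (4 + 1) + 2)) 4"
    by (intro triple_mono[OF triple_block]) auto
qed simp

lemma chosen_value_cong:
  assumes "\<And>r. r \<in> kept \<Longrightarrow> X r = Y r" "j \<le> d"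
  shows "chosen_value num toks X j z = chosen_value num toks Y j z"
  using assms(2) by (induction j) (simp_all add: assms(1) kept_simps)

lemma in_range_good:
  assumes X: "input_ok X" and U: "in_range kept (choices d) X U"
  shows "good U"
proof -
  have regs: "15 \<le> r \<and> r \<le> base d" if "r \<in> fst ` set (choices d)" for r
    using that by (auto simp: set_choices pos_reg_def val_reg_def base_def)
  have same: "U r = X r" if "r \<in> kept" "r < 15 \<or> base d < r" for r
    using that regs[of r] U unfolding in_range_def by force
  have "U (base d + 1 + q) = toks ! q" if "q < n" for q
    using same[OF kept_simps(18)[OF that]] X that unfolding input_ok_def by simp
  then have "input_ok U"
    using same kept_simps X unfolding input_ok_def by simp
  moreover have "0 < U (pos_reg j) \<and> U (pos_reg j) \<le> X 1 \<and> 0 < U (val_reg j) \<and> U (val_reg j) \<le> X 4" if "j < d" for j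
  proof -
    have "(pos_reg j, 1) \<in> set (choices d)" "(val_reg j, 4) \<in> set (choices d)"
      using that by (auto simp: set_choices)
    then show ?thesis
      using U unfolding in_range_def by fastforce
  qed
  ultimately show ?thesis
    using X unfolding good_def input_ok_def by simp
qed

text \<open>Completeness of the search: list the support of \<open>w\<close> and choose for each of
  its variables a position where it occurs. Surplus choices are filled with arbitrary positions,
  which is why the input must be nonempty.\<close>

lemma ex_in_range_assignment:
  assumes X: "input_ok X" and "0 < n"
    and w: "card {i. w i \<noteq> 0} \<le> d" "finite {i. w i \<noteq> 0}"
    and occurs: "\<And>i. w i \<noteq> 0 \<Longrightarrow> 4 + CARD('a) + i \<in> set toks"
  shows "\<exists>U. in_range kept (choices d) X U \<and> assignment U = w"
proof -
  obtain xs where xs: "set xs = {i. w i \<noteq> 0}" "length xs \<le> d"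
    using w by (metis finite_distinct_list distinct_card)
  have "\<exists>q<n. j < length xs \<longrightarrow> toks ! q = 4 + CARD('a) + xs ! j" for j
  proof (cases "j < length xs")
    case True
    then have "w (xs ! j) \<noteq> 0"
      using xs(1) nth_mem by fastforce
    then show ?thesis
      using occurs by (metis in_set_conv_nth)
  qed (use \<open>0 < n\<close> in auto)
  then obtain pos where pos: "\<And>j. pos j < n"
      "\<And>j. j < length xs \<Longrightarrow> toks ! pos j = 4 + CARD('a) + xs ! j"
    by metis
  \<comment> \<open>The value depends on the token, not on the number of the choice. Surplus or
    repeated positions thus also receive the value prescribed by \<open>w\<close>, and overriding
    cannot create a conflict.\<close>
  define val where "val z = (if 4 + CARD('a) \<le> z then w (z - 4 - CARD('a)) else 0)" for z
  \<comment> \<open>Odd registers from 15 on hold positions and even ones hold values;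
    \<open>Suc\<close> is the offset 1 of both.\<close>
  define U where "U r = (if 15 \<le> r \<and> r < base d then
      if odd r then Suc (pos ((r - 15) div 2)) else Suc (num (val (toks ! pos ((r - 16) div 2))))
      else X r)" for r
  have U_pos: "U (pos_reg j) = Suc (pos j)" and U_val: "U (val_reg j) = Suc (num (val (toks ! pos j)))"
    if "j < d" for j
    using that by (simp_all add: U_def pos_reg_def val_reg_def base_def)
  have chosen: "chosen_value num toks U j (4 + CARD('a) + i) =
      (if \<exists>k<j. toks ! pos k = 4 + CARD('a) + i then w i else 0)" if "j \<le> d" for i j
    using that
  proof (induction j)
    case (Suc j)
    then show ?case
      by (auto simp: U_pos U_val val_def less_Suc_eq)
  qed simp
  have "assignment U i = w i" for i
  proof (cases "w i = 0")
    case False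
    then obtain k where "k < length xs" "xs ! k = i"
      using xs(1) by (metis (mono_tags) in_set_conv_nth mem_Collect_eq)
    then have "\<exists>k<d. toks ! pos k = 4 + CARD('a) + i"
      using pos(2) xs(2) by (metis less_le_trans)
    then show ?thesis
      unfolding assignment_def chosen[OF order_refl] by simp
  qed (simp add: assignment_def chosen)
  moreover have "in_range kept (choices d) X U"
  proof -
    have "U r = X r" if "r \<notin> fst ` set (choices d)" for r
    proof (cases "15 \<le> r \<and> r < base d")
      case True
      have "r \<in> fst ` set (choices d)"
      proof (cases "odd r")
        case odd: True
        then have "r = pos_reg ((r - 15) div 2)" "(r - 15) div 2 < d"
          using True by (auto simp: pos_reg_def base_def elim!: oddE)
        then show ?thesis
          unfolding set_choices by (intro image_eqI[of _ _ "(r, 1)"]) auto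
      next
        case even: False
        then have "16 \<le> r"
          using True by (cases "r = 15") auto
        then have "r = val_reg ((r - 16) div 2)" "(r - 16) div 2 < d"
          using True even by (auto simp: val_reg_def base_def)
        then show ?thesis
          unfolding set_choices by (intro image_eqI[of _ _ "(r, 4)"]) auto
      qed
      then show ?thesis
        using that by simp
    qed (auto simp: U_def)
    moreover have "0 < U (fst l) \<and> U (fst l) \<le> X (snd l)" if "l \<in> set (choices d)" for l
      using that X pos(1) num_less unfolding set_choices input_ok_def
      by (auto simp: U_pos U_val Suc_le_eq)
    ultimately show ?thesis
      unfolding in_range_def by blast
  qed
  ultimately show ?thesis
    by blast
qed

end

text \<open>Each choice is a pair of nested loops, hence 36 = 6 * 6.\<close>

lemma prod_list_choices:
  "prod_list (map (\<lambda>l. 6 * X (snd l)) (choices d)) = (36 * X 1 * X 4) ^ d" for X :: "nat \<Rightarrow> nat"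
  by (induction d) (simp_all add: choices_def)

lemma distinct_choices: "distinct (map fst (choices d))"
proof -
  have "choices (Suc d) = choices d @ [(pos_reg d, 1), (val_reg d, 4)]" for d
    by (simp add: choices_def)
  moreover have "choices 0 = []"
    by (simp add: choices_def)
  ultimately show ?thesis
    by (induction d) (auto simp: set_choices pos_reg_def val_reg_def dest: arg_cong[where f = even])
qed

lemma encode_expr_pos: "z \<in> set (encode_expr num f) \<Longrightarrow> 0 < z"
  by (induction f) auto

lemma encode_expr_vars: "i \<in> vars f \<Longrightarrow> 4 + CARD('a) + i \<in> set (encode_expr num f)" for f :: "'a expr"
  by (induction f) auto

lemma expr_length_pos: "0 < expr_length f"
  by (induction f) simp_all

lemma triple_search:
  fixes f :: "'a::{finite,ring} expr"
  assumes num: "bij_betw num (UNIV :: 'a set) {..<CARD('a)}"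
    and small: "solvable f \<Longrightarrow>
      \<exists>w. {i. w i \<noteq> 0} \<subseteq> vars f \<and> card {i. w i \<noteq> 0} \<le> d \<and> eval_expr w f = 0"
    and n: "n = expr_length f"
  shows "triple (search num d) (\<lambda>_. 0) (encode_expr num f) (\<lambda>X w. 0 < X 2 \<longleftrightarrow> solvable f)
    ((5 * n + 6) + (n * (9 * CARD('a) + 8 * d + 29) + 3 * CARD('a) + 7) * (36 * n * CARD('a)) ^ d)"
proof -
  interpret search_machine num d "encode_expr num f"
    by unfold_locales (rule num)
  have len: "length (encode_expr num f) = n"
    by (simp add: n length_encode_expr)
  let ?B = "n * (9 * CARD('a) + 8 * d + 29) + 3 * CARD('a) + 7"
  let ?F = "\<lambda>X. eval_expr (assignment X) f = 0"
  have nest: "triple (nest (choices d) (evaluate num d)) X w (\<lambda>X w. 0 < X 2 \<longleftrightarrow> solvable f)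
      (?B * (36 * n * CARD('a)) ^ d)" if X: "input_ok X" "X 2 = 0" for X w
  proof -
    have "triple (nest (choices d) (evaluate num d)) X w
      (\<lambda>X' w'. (\<forall>r\<in>kept - fst ` set (choices d). X' r = X r) \<and>
        (0 < X' 2 \<longleftrightarrow> 0 < X 2 \<or> (\<exists>U. in_range kept (choices d) X U \<and> ?F U)))
      (?B * prod_list (map (\<lambda>l. 6 * X (snd l)) (choices d)))"
    proof (rule triple_nest[where Good = good])
      show "triple (evaluate num d) X w
        (\<lambda>X' w'. (\<forall>r\<in>kept. X' r = X r) \<and> (0 < X' 2 \<longleftrightarrow> 0 < X 2 \<or> ?F X)) ?B" if "good X" for X w
        using triple_evaluate[OF that, of "eval_expr (assignment X) f" w]
          run_tokens_encode_expr[OF num, of "assignment X" f "[]"] by (simp add: len)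
      show "?F X = ?F Y" if "\<And>r. r \<in> kept \<Longrightarrow> X r = Y r" for X Y
        using chosen_value_cong[OF that] unfolding assignment_def by simp
      show "0 \<in> kept" "14 \<in> kept" "2 \<notin> kept"
        by (simp_all add: kept_simps)
      show "distinct (map fst (choices d))"
        by (rule distinct_choices)
      show "fst ` set (choices d) \<subseteq> kept" "snd ` set (choices d) \<subseteq> kept"
        using kept_simps(12) by (auto simp: set_choices kept_simps)
      show "fst ` set (choices d) \<inter> (snd ` set (choices d) \<union> {0, 14}) = {}"
        by (auto simp: set_choices pos_reg_def val_reg_def)
      show "good U" if "in_range kept (choices d) X U" for U
        using in_range_good[OF X(1) that] .
      show "X 0 = 1" "X 14 = 0"
        using X(1) by (simp_all add: input_ok_def)
      show "\<forall>l\<in>set (choices d). 0 < X (snd l)"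
        using X(1) len expr_length_pos[of f] by (auto simp: set_choices input_ok_def n)
    qed simp
    moreover have "(\<exists>U. in_range kept (choices d) X U \<and> ?F U) \<longleftrightarrow> solvable f"
    proof
      assume "solvable f"
      then obtain w where w: "{i. w i \<noteq> 0} \<subseteq> vars f" "card {i. w i \<noteq> 0} \<le> d" "eval_expr w f = 0"
        using small by blast
      have "\<exists>U. in_range kept (choices d) X U \<and> assignment U = w"
      proof (rule ex_in_range_assignment[OF X(1) _ w(2)])
        show "finite {i. w i \<noteq> 0}"
          using w(1) finite_vars finite_subset by blast
        show "4 + CARD('a) + i \<in> set (encode_expr num f)" if "w i \<noteq> 0" for i
          using that w(1) by (intro encode_expr_vars) auto
      qed (use len expr_length_pos[of f] n in simp)
      then show "\<exists>U. in_range kept (choices d) X U \<and> ?F U"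
        using w(3) by blast
    qed (auto simp: solvable_def)
    moreover have "prod_list (map (\<lambda>l. 6 * X (snd l)) (choices d)) = (36 * n * CARD('a)) ^ d"
      using X(1) len by (simp add: prod_list_choices input_ok_def)
    ultimately show ?thesis
      using X(2) by (auto elim!: triple_mono)
  qed
  have "triple (read_input (CARD('a)) d) (\<lambda>_. 0) (encode_expr num f)
      (\<lambda>X' w'. triple (nest (choices d) (evaluate num d)) X' w' (\<lambda>X w. 0 < X 2 \<longleftrightarrow> solvable f)
        (?B * (36 * n * CARD('a)) ^ d)) (5 * n + 6)"
    using triple_read_input[OF encode_expr_pos[of _ num f]] unfolding len
    by (rule triple_mono) (use nest in auto)
  then show ?thesis
    unfolding search_def by (rule triple_seq) simp
qed

lemma decider_halts:
  assumes "triple (search num d) (\<lambda>_. 0) w (\<lambda>X w. 0 < X 2 \<longleftrightarrow> b) K"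
  shows "\<exists>t\<le>K + 2. (step (decider num d) ^^ t) (init_config w) = Halted b"
proof -
  let ?P = "decider num d" and ?l = "length (search num d 0)"
  have "code_at ?P 0 (search num d 0)"
    unfolding code_at_def decider_def by auto
  then have "run ?P 0 (\<lambda>_. 0) w ?l (\<lambda>X w. 0 < X 2 \<longleftrightarrow> b) K"
    by (rule tripleD[OF assms]) simp
  then obtain t X' w' where t: "t \<le> K" "(step ?P ^^ t) (init_config w) = Running ?l X' w'" "0 < X' 2 \<longleftrightarrow> b"
    unfolding run_def init_config_def by blast
  have "step ?P (step ?P (Running ?l X' w')) = Halted b"
    using t(3) by (auto simp: decider_def nth_append)
  then have "(step ?P ^^ (t + 2)) (init_config w) = Halted b"
    using t(2) by (simp add: numeral_2_eq_2)
  then show ?thesis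
    using t(1) by (intro exI[of _ "t + 2"]) simp
qed

section \<open>Running time\<close>

text \<open>For N at least 4, 2 log N is at least 4 and N^4 suffices. The small cases are 2 against
  4 for N = 2, and 17 against 27 for N = 3, where 2 log 3 = log 9 exceeds 3. The factor log^5 N is
  at least 1.\<close>

lemma time_exponent_ge:
  assumes "2 \<le> N"
  shows "real ((N - 1) ^ 4 + 1) \<le> real N powr (2 * log 2 (real N)) * log 2 (real N) ^ 5"
proof -
  let ?L = "log 2 (real N)"
  have L: "1 \<le> ?L"
    using assms by simp
  have "real ((N - 1) ^ 4 + 1) \<le> real N powr (2 * ?L)"
  proof -
    consider "N = 2" | "N = 3" | "4 \<le> N"
      using assms by linarith
    then show ?thesis
    proof cases
      case 1
      then show ?thesis
        by simp
    next
      case 2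
      have "3 = log 2 (2 ^ 3 :: real)"
        by (subst log_pow_cancel) auto
      also have "\<dots> \<le> log 2 (3 ^ 2)"
        by (subst log_le_cancel_iff) auto
      also have "\<dots> = 2 * log 2 3"
        using log_nat_power[of 3 2 2] by simp
      finally have "(3::real) powr 3 \<le> 3 powr (2 * log 2 3)"
        by (intro powr_mono) auto
      then show ?thesis
        using 2 by simp
    next
      case 3
      have "2 = log 2 (2 ^ 2 :: real)"
        by (subst log_pow_cancel) auto
      also have "\<dots> \<le> ?L"
        using 3 by (subst log_le_cancel_iff) auto
      finally have "real N powr 4 \<le> real N powr (2 * ?L)"
        using 3 by (intro powr_mono) auto
      moreover have "(N - 1) ^ 4 < N ^ 4"
        using assms by (intro power_strict_mono) auto
      then have "(N - 1) ^ 4 + 1 \<le> N ^ 4"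
        by simp
      then have "real ((N - 1) ^ 4 + 1) \<le> real (N ^ 4)"
        by (rule of_nat_mono)
      ultimately show ?thesis
        using assms by simp
    qed
  qed
  also have "\<dots> \<le> real N powr (2 * ?L) * ?L ^ 5"
    using mult_left_mono[OF one_le_power[OF L], of "real N powr (2 * ?L)" 5] by simp
  finally show ?thesis .
qed

theorem mainTheorem2:
  fixes num :: "'a::{finite,ring} \<Rightarrow> nat"
  assumes "nilpotent_ring TYPE('a)"
    and "bij_betw num (UNIV :: 'a set) {..<CARD('a)}"
  shows "decidable_in_O_time (encode_expr num) (solvable :: 'a expr \<Rightarrow> bool)
    (\<lambda>f. real (expr_length f) powr
      (real CARD('a) powr (2 * log 2 (real CARD('a))) * (log 2 (real CARD('a))) ^ 5))"
proof (cases "CARD('a) = 1")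
  \<comment> \<open>In the zero ring every equation holds, and log 1 = 0 makes the exponent 0:
    accepting in one step meets the constant bound.\<close>
  case True
  then have "x = y" for x y :: 'a
    by (metis (full_types) UNIV_I card_1_singletonE singletonD)
  then have "solvable f" for f :: "'a expr"
    unfolding solvable_def by blast
  then show ?thesis
    unfolding decidable_in_O_time_def using True expr_length_pos
    by (intro exI[of _ "[Accept]"] exI[of _ 1] allI exI[of _ 1]) (simp add: init_config_def)
next
  case False
  let ?N = "CARD('a)"
  let ?d = "(?N - 1) ^ 4"
  let ?E = "real ?N powr (2 * log 2 (real ?N)) * log 2 (real ?N) ^ 5"
  \<comment> \<open>Lower-order terms are absorbed using n at least 1: 13 = 5 + 8 covers reading the
    input and halting, and the remaining terms of one evaluation are folded into a multiple of
    n.\<close>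
  define c where "c = 13 + (12 * ?N + 8 * ?d + 36) * (36 * ?N) ^ ?d"
  have N: "2 \<le> ?N"
    using False zero_less_card_finite[where 'a = 'a] by linarith
  show ?thesis
    unfolding decidable_in_O_time_def
  proof (intro exI[of _ "decider num ?d"] exI[of _ "real c"] allI)
    fix f :: "'a expr"
    define n where "n = expr_length f"
    have n: "1 \<le> n"
      using expr_length_pos[of f] by (simp add: n_def)
    let ?K = "(5 * n + 6) + (n * (9 * ?N + 8 * ?d + 29) + 3 * ?N + 7) * (36 * n * ?N) ^ ?d"
    obtain t where t: "t \<le> ?K + 2" "(step (decider num ?d) ^^ t) (init_config (encode_expr num f)) = Halted (solvable f)"
      using decider_halts[OF triple_search[OF assms(2) solvable_small_support[OF assms(1)] n_def]] by blast
    have "?K + 2 \<le> c * n ^ (?d + 1)"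
    proof -
      have "n \<le> n ^ (?d + 1)"
        using n by (intro self_le_power) auto
      then have 1: "5 * n + 8 \<le> 13 * n ^ (?d + 1)"
        using n by linarith
      have "3 * ?N + 7 \<le> n * (3 * ?N + 7)"
        using n by simp
      then have "n * (9 * ?N + 8 * ?d + 29) + 3 * ?N + 7 \<le> n * (12 * ?N + 8 * ?d + 36)"
        by (simp add: algebra_simps)
      then have "(n * (9 * ?N + 8 * ?d + 29) + 3 * ?N + 7) * (36 * n * ?N) ^ ?d
          \<le> n * (12 * ?N + 8 * ?d + 36) * (36 * n * ?N) ^ ?d"
        by (rule mult_le_mono1)
      also have "\<dots> = (12 * ?N + 8 * ?d + 36) * (36 * ?N) ^ ?d * n ^ (?d + 1)"
        by (simp only: power_mult_distrib power_add power_one_right mult_ac)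
      finally show ?thesis
        using 1 unfolding c_def add_mult_distrib by linarith
    qed
    then have "real t \<le> real (c * n ^ (?d + 1))"
      using t(1) by (meson le_trans of_nat_mono)
    also have "\<dots> = real c * real n powr real (?d + 1)"
      using n by (subst powr_realpow) auto
    also have "\<dots> \<le> real c * real n powr ?E"
      using n time_exponent_ge[OF N] by (intro mult_left_mono powr_mono) auto
    finally show "\<exists>t. real t \<le> real c * real (expr_length f) powr ?E \<and>
        (step (decider num ?d) ^^ t) (init_config (encode_expr num f)) = Halted (solvable f)"
      using t(2) unfolding n_def by blast
  qed
qed

end
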